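(* Let $Z^\star\in\mathbb{R}^{d_1\times d_2}$ have rank $r^\star\le r$, and let $\mathcal{I}\subseteq[m]$. Suppose the linear map $\mathcal{A}:\mathbb{R}^{d_1\times d_2}\to\mathbb{R}^m$ satisfies, for constants $\omega_0,\omega_1,\omega_2>0$ and all $Z$ of rank at most $2r$, $$\omega_1\|Z\|_F\le\|\mathcal{A}(Z)\|_1\le\omega_2\|Z\|_F\qquad\text{and}\qquad\omega_0\|Z\|_F\le\|\mathcal{A}_{\mathcal{I}^c}(Z)\|_1-\|\mathcal{A}_{\mathcal{I}}(Z)\|_1.$$ Let $b\in\mathbb{R}^m$ be given by $b_i=\mathcal{A}(Z^\star)_i$ for $i\in\mathcal{I}^c$ and $b_i=\eta_i$ for $i\in\mathcal{I}$, where the $\eta_i\in\mathbb{R}$ are arbitrary. Let $X^\star(Y^\star)^\top=Z^\star$, $X^\star\in\mathbb{R}^{d_1\times r}$, $Y^\star\in\mathbb{R}^{d_2\times r}$, be a factorization with $\operatorname{rank}(X^\star)=\operatorname{rank}(Y^\star)=r^\star$ and matching right singular vectors $V^{X^\star}=V^{Y^\star}$. Apply the LMM subgradient method with $F(X,Y)=XY^\top$ and $h(Z)=\|\mathcal{A}(Z)-b\|_1$, initialized at $(X_0,Y_0)\in\mathbb{R}^{d_1\times r}\times\mathbb{R}^{d_2\times r}$ and with the Polyak configuration with parameters $\gamma,C_{\mathtt{lb}},C_{\mathtt{ub}}$ satisfying $\gamma\le\min\left\{1,\frac{C_{\mathtt{lb}}}{\sqrt2}\right\}$ and $$C_{\mathtt{ub}}\le\frac{1}{2^7\cdot5\sqrt2\,(r-r^\star+1)^2}\frac{\omega_0^2}{\omega_2^2}\frac{\min\{\sigma_{r^\star}^2(X^\star),\sigma_{r^\star}^2(Y^\star)\}}{\sigma_{r^\star}^2(X^\star)+\sigma_{r^\star}^2(Y^\star)},$$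 and suppose $$\|(X_0,Y_0)-(X^\star,Y^\star)\|_F\le\frac{1}{32\sqrt2}\frac{\min\{\sigma_{r^\star}^2(X^\star),\sigma_{r^\star}^2(Y^\star)\}}{\max\{\sigma_1(X^\star),\sigma_1(Y^\star)\}},$$ $$\|X_0Y_0^\top-Z^\star\|_F\le\frac{1}{2^{19}}\frac{\omega_0^4}{\omega_2^4}\frac{\min\{\sigma_{r^\star}^4(X^\star),\sigma_{r^\star}^4(Y^\star)\}}{\min\{\sigma_1^2(X^\star),\sigma_1^2(Y^\star)\}}C_{\mathtt{lb}}.$$ Then the iterates satisfy $$\|X_kY_k^\top-Z^\star\|_F^2\le\left(1-\frac{\gamma}{8}\frac{\omega_0^2}{\omega_2^2}\right)^k\|X_0Y_0^\top-Z^\star\|_F^2\quad\text{for all }k\ge0.$$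
   Context: Matrix spaces carry the trace inner product and Frobenius norm; $\|(X,Y)\|_F^2=\|X\|_F^2+\|Y\|_F^2$. $\sigma_i(\cdot)$ is the $i$-th largest singular value. $V^{X^\star}=V^{Y^\star}$ means that $X^\star$ and $Y^\star$ admit (full) singular value decompositions $X^\star=U^{X^\star}\Sigma^{X^\star}V^\top$, $Y^\star=U^{Y^\star}\Sigma^{Y^\star}V^\top$ (singular values nonincreasing) with the same orthogonal $V\in\mathbb{R}^{r\times r}$. $[m]=\{1,\dots,m\}$, $\mathcal{I}^c=[m]\setminus\mathcal{I}$, and $\mathcal{A}_{\mathcal{J}}(Z)$ is the subvector of $\mathcal{A}(Z)$ indexed by $\mathcal{J}$. LMM (Levenberg-Morrison-Marquardt) subgradient method for $f=h\circ F$, $F:\mathbf{E}\to\mathbf{Y}$. Given $x_0$, stepsizes $\gamma_k>0$ and damping coefficients $\lambda_k>0$: for $k\ge0$ pick any $v_k\in\partial h(F(x_k))$ (convex subdifferential) and set $x_{k+1}=x_k-\gamma_k(\nabla F(x_k)^\top\nabla F(x_k)+\lambda_kI)^{-1}\nabla F(x_k)^\top v_k$, where $\nabla F(x)$ is the derivative (a linear map) and $\nabla F(x)^\top$ its adjoint. Here $x_k=(X_k,Y_k)$. Write $z_k=F(x_k)$; let $h^\star$, $\mathcal{Z}^\star$ be the minimum value and set of minimizers of $h$ over $\operatorname{Im}F$, and $\Pi^x$ the orthogonal projection onto the range of $\nabla F(x)$. Polyak configuration with parameters $\gamma>0$, $0<C_{\mathtt{lb}}\le C_{\mathtt{ub}}$: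 $\gamma_k=\gamma\frac{h(z_k)-h^\star}{\|\Pi^{x_k}v_k\|^2}$ and $C_{\mathtt{lb}}\operatorname{dist}(z_k,\mathcal{Z}^\star)\le\lambda_k\le C_{\mathtt{ub}}\operatorname{dist}(z_k,\mathcal{Z}^\star)$ for all $k$. *)

theory Defs
  imports "HOL-Analysis.Analysis" "HOL-Library.Countable_Set"
begin

text \<open>
  A matrix in \<open>\<real>\<^sup>m\<^sup>\<times>\<^sup>n\<close> is an element of \<open>real ^ 'n ^ 'm\<close>, and a pair of matrices is an element
  of a product type. On these types the library's \<open>inner\<close> is the trace inner product and \<open>norm\<close>
  the Frobenius norm, with \<open>norm (X, Y) ^ 2 = norm X ^ 2 + norm Y ^ 2\<close>.
\<close>

subsection \<open>Singular value decompositions\<close>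

text \<open>
  Index types carry no order, so we fix one numbering \<open>1, ..., CARD('n)\<close> of each of them.
  It is the same for all matrices over that type; this matters for \<open>same_right_singular_vectors\<close>
  below, where the columns of the shared factor must be matched with both lists of singular
  values in the same order.
\<close>

definition pos :: "'n::finite \<Rightarrow> nat" where
  "pos i = Suc (to_nat_on (UNIV :: 'n set) i)"

definition rect_diag :: "(nat \<Rightarrow> real) \<Rightarrow> real ^ 'n ^ 'm" where
  "rect_diag s = (\<chi> i j. if pos i = pos j then s (pos i) else 0)"

text \<open>
  The diagonal \<open>s 1 \<ge> s 2 \<ge> ...\<close> is padded by \<open>0\<close> outside the admissible indices
  \<open>1, ..., min m n\<close>.
\<close>

definition is_svd ::
    "real ^ 'm ^ 'm \<Rightarrow> (nat \<Rightarrow> real) \<Rightarrow> real ^ 'n ^ 'n \<Rightarrow> real ^ 'n ^ 'm \<Rightarrow> bool" where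
  "is_svd U s V X \<longleftrightarrow>
     orthogonal_matrix U \<and> orthogonal_matrix V \<and>
     (\<forall>i. 0 \<le> s i) \<and>
     (\<forall>i j. 1 \<le> i \<and> i \<le> j \<and> j \<le> min CARD('m) CARD('n) \<longrightarrow> s j \<le> s i) \<and>
     (\<forall>i. i \<notin> {1..min CARD('m) CARD('n)} \<longrightarrow> s i = 0) \<and>
     X = U ** rect_diag s ** transpose V"

text \<open>
  The \<open>i\<close>-th largest singular value, counted from \<open>i = 1\<close>. Every real matrix has a singular value
  decomposition and all of its decompositions have the same \<open>s\<close>; because of the padding,
  \<open>singular_value 0 X = 0\<close>.
\<close>

definition singular_value :: "nat \<Rightarrow> real ^ 'n ^ 'm \<Rightarrow> real" where
  "singular_value i X = (THE t. \<exists>U s V. is_svd U s V X \<and> t = s i)"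

definition same_right_singular_vectors :: "real ^ 'r ^ 'm \<Rightarrow> real ^ 'r ^ 'n \<Rightarrow> bool" where
  "same_right_singular_vectors X Y \<longleftrightarrow>
     (\<exists>V U s W t. is_svd U s V X \<and> is_svd W t V Y)"

subsection \<open>The LMM subgradient method with Polyak stepsizes\<close>

definition l1_on :: "'m set \<Rightarrow> real ^ 'm \<Rightarrow> real" where
  "l1_on J y = (\<Sum>i\<in>J. \<bar>y $ i\<bar>)"

definition subdifferential :: "('z::real_inner \<Rightarrow> real) \<Rightarrow> 'z \<Rightarrow> 'z set" where
  "subdifferential h z = {v. \<forall>w. h w \<ge> h z + inner v (w - z)}"

definition orth_proj :: "'z::real_inner set \<Rightarrow> 'z \<Rightarrow> 'z" where
  "orth_proj S v = (THE p. p \<in> S \<and> (\<forall>w\<in>S. orthogonal (v - p) w))"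

definition min_value :: "('z \<Rightarrow> real) \<Rightarrow> ('x \<Rightarrow> 'z) \<Rightarrow> real" where
  "min_value h F = Inf (h ` range F)"

definition min_set :: "('z \<Rightarrow> real) \<Rightarrow> ('x \<Rightarrow> 'z) \<Rightarrow> 'z set" where
  "min_set h F = {z \<in> range F. \<forall>w \<in> range F. h z \<le> h w}"

definition lmm_step ::
    "('z::euclidean_space \<Rightarrow> real) \<Rightarrow> ('x::euclidean_space \<Rightarrow> 'z) \<Rightarrow>
     real \<Rightarrow> real \<Rightarrow> 'z \<Rightarrow> 'x \<Rightarrow> 'x \<Rightarrow> bool" where
  "lmm_step h F \<gamma> lam v x x' \<longleftrightarrow>
     0 < \<gamma> \<and> 0 < lam \<and> v \<in> subdifferential h (F x) \<and>
     (let D = frechet_derivative F (at x) in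
        x' = x - \<gamma> *\<^sub>R inv (\<lambda>u. adjoint D (D u) + lam *\<^sub>R u) (adjoint D v))"

definition polyak_params ::
    "('z::euclidean_space \<Rightarrow> real) \<Rightarrow> ('x::euclidean_space \<Rightarrow> 'z) \<Rightarrow>
     real \<Rightarrow> real \<Rightarrow> real \<Rightarrow> 'x \<Rightarrow> 'z \<Rightarrow> real \<Rightarrow> real \<Rightarrow> bool" where
  "polyak_params h F \<gamma> Clb Cub x v \<gamma>k lamk \<longleftrightarrow>
     \<gamma>k = \<gamma> * (h (F x) - min_value h F) /
            (norm (orth_proj (range (frechet_derivative F (at x))) v))\<^sup>2 \<and>
     Clb * infdist (F x) (min_set h F) \<le> lamk \<and>
     lamk \<le> Cub * infdist (F x) (min_set h F)"

text \<open>
  At a minimizer the Polyak rule forces stepsize and damping to be \<open>0\<close>, so no step with positive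
  parameters exists. The method then stops, and we continue the sequence of iterates constantly.
\<close>

definition lmm_polyak ::
    "('z::euclidean_space \<Rightarrow> real) \<Rightarrow> ('x::euclidean_space \<Rightarrow> 'z) \<Rightarrow> real \<Rightarrow> real \<Rightarrow> real \<Rightarrow>
     (nat \<Rightarrow> 'x) \<Rightarrow> (nat \<Rightarrow> 'z) \<Rightarrow> (nat \<Rightarrow> real) \<Rightarrow> (nat \<Rightarrow> real) \<Rightarrow> bool" where
  "lmm_polyak h F \<gamma> Clb Cub x v \<gamma>s lams \<longleftrightarrow>
     (\<forall>k. if F (x k) \<in> min_set h F then x (Suc k) = x k
          else polyak_params h F \<gamma> Clb Cub (x k) (v k) (\<gamma>s k) (lams k) \<and>
               lmm_step h F (\<gamma>s k) (lams k) (v k) (x k) (x (Suc k)))"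

end

theory Submission
  imports Defs
begin

text \<open>
  Write \<open>z = X Y\<^sup>T\<close>, \<open>e = z - Z\<^sup>\<star>\<close>, \<open>E = \<parallel>e\<parallel>\<close>, and let \<open>D (U, W) = U Y\<^sup>T + X W\<^sup>T\<close> be the derivative of the
  factorization map. One step moves \<open>z\<close> by \<open>- \<gamma>\<^sub>k P v\<close>, where \<open>P = D (D\<^sup>T D + \<lambda>)\<^sup>-\<^sup>1 D\<^sup>T\<close> is a damped version
  of the orthogonal projection \<open>\<Pi>\<close> onto the range of \<open>D\<close>, up to the quadratic term of the factorization. The
  outlier bound makes \<open>h\<close> sharp, \<open>\<Delta> = h z - h Z\<^sup>\<star> \<ge> \<omega>\<^sub>0 E\<close>, so that \<open>Z\<^sup>\<star>\<close> is the only minimizer over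
  the range of the factorization, and the upper bound gives \<open>\<parallel>\<Pi> v\<parallel> \<le> \<omega>\<^sub>2\<close>. If \<open>P e\<close> were equal to \<open>e\<close>, then
  \<open>\<langle>P v, e\<rangle> = \<langle>v, e\<rangle> \<ge> \<Delta>\<close>, and the usual Polyak computation would contract \<open>E\<^sup>2\<close> by a factor
  \<open>1 - const \<gamma> \<omega>\<^sub>0\<^sup>2 / \<omega>\<^sub>2\<^sup>2\<close>. The whole question is thus how small the residual \<open>p = e - P e\<close> is. If
  \<open>r\<^sup>\<star> < r\<close>, then \<open>D\<close> can have arbitrarily small nonzero singular values near \<open>(X\<^sup>\<star>, Y\<^sup>\<star>)\<close>, so \<open>p\<close> is small
  only because \<open>e\<close> is not an arbitrary matrix.

  The residual satisfies \<open>\<lambda> (e - p) = X X\<^sup>T p + p Y Y\<^sup>T\<close>. Two facts control it.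

  \<^item> The inner product of the two summands on the right is \<open>\<parallel>X\<^sup>T p Y\<parallel>\<^sup>2\<close>, and \<open>4 \<langle>a, b\<rangle> \<le> \<parallel>a + b\<parallel>\<^sup>2\<close>. Hence
    \<open>\<parallel>X\<^sup>T p Y\<parallel> \<le> \<lambda> E / 2\<close>, whatever the singular values of \<open>X\<close> and \<open>Y\<close> are (\<open>damped_identities\<close>).
  \<^item> Let \<open>L\<close>, \<open>M\<close> be the pseudo-inverses of \<open>X\<^sup>\<star>\<close>, \<open>Y\<^sup>\<star>\<close>. Because the right singular vectors match,
    \<open>N = M\<^sup>T L\<close> satisfies \<open>Z\<^sup>\<star> N Z\<^sup>\<star> = Z\<^sup>\<star>\<close>. Substituting \<open>Z\<^sup>\<star> = z - e\<close> into this identity gives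
    \<open>e = X (1 - Y\<^sup>T N X) Y\<^sup>T + e N X Y\<^sup>T + X Y\<^sup>T N e - e N e\<close> (\<open>error_decomposition\<close>).

  Pairing this decomposition with \<open>p\<close>, the first term costs \<open>\<parallel>1 - Y\<^sup>T N X\<parallel> \<lambda> E / 2\<close>, and \<open>1 - Y\<^sup>T N X\<close> is
  close to a projection of rank \<open>r - r\<^sup>\<star>\<close>; the middle terms are paired with \<open>p Y\<close> and \<open>X\<^sup>T p\<close>, which the energy
  identity \<open>\<lambda> \<langle>e, p\<rangle> = \<lambda> \<parallel>p\<parallel>\<^sup>2 + \<parallel>p Y\<parallel>\<^sup>2 + \<parallel>X\<^sup>T p\<parallel>\<^sup>2\<close> absorbs; the last one is of higher order in \<open>E\<close>. With
  \<open>\<lambda> \<le> C\<^sub>u\<^sub>b E\<close> this yields \<open>\<parallel>p\<parallel> \<le> (\<omega>\<^sub>0 / \<omega>\<^sub>2) E / 32\<close> (\<open>damped_residual_bound\<close>, \<open>residual_smallness_arith\<close>), as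
  long as the factors are within a tenth of the smallest nonzero singular value of \<open>X\<^sup>\<star>\<close> and \<open>Y\<^sup>\<star>\<close>.

  It remains to see that the factors stay that close. A step has length at most \<open>\<gamma> \<surd>(E / C\<^sub>l\<^sub>b)\<close>
  (\<open>damped_polyak_step\<close>), and \<open>\<surd>E\<close> decreases geometrically, so the distance to \<open>(X\<^sup>\<star>, Y\<^sup>\<star>)\<close> plus a
  suitable multiple of \<open>\<surd>E\<close> never increases (\<open>geometric_potential_step\<close>); the two initialization
  conditions bound its initial value.
\<close>

section \<open>Frobenius norm, matrix products and rank\<close>

lemma inner_matrix:
  fixes A B :: "real ^ 'n ^ 'm"
  shows "A \<bullet> B = (\<Sum>i\<in>UNIV. \<Sum>j\<in>UNIV. A $ i $ j * B $ i $ j)"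
  by (simp add: inner_vec_def)

lemma inner_transpose:
  fixes A B :: "real ^ 'n ^ 'm"
  shows "transpose A \<bullet> transpose B = A \<bullet> B"
  unfolding inner_matrix transpose_def by (simp, rule sum.swap)

lemma norm_transpose [simp]:
  fixes A :: "real ^ 'n ^ 'm"
  shows "norm (transpose A) = norm A"
  by (simp add: norm_eq_sqrt_inner inner_transpose)

lemma inner_matrix_mult_left:
  fixes A :: "real ^ 'k ^ 'm" and B :: "real ^ 'n ^ 'k" and C :: "real ^ 'n ^ 'm"
  shows "(A ** B) \<bullet> C = B \<bullet> (transpose A ** C)"
proof -
  have "(A ** B) \<bullet> C = (\<Sum>i\<in>UNIV. \<Sum>j\<in>UNIV. \<Sum>k\<in>UNIV. A $ i $ k * B $ k $ j * C $ i $ j)"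
    by (simp add: inner_matrix matrix_matrix_mult_def sum_distrib_right)
  also have "\<dots> = (\<Sum>i\<in>UNIV. \<Sum>k\<in>UNIV. \<Sum>j\<in>UNIV. A $ i $ k * B $ k $ j * C $ i $ j)"
    by (intro sum.cong refl sum.swap)
  also have "\<dots> = (\<Sum>k\<in>UNIV. \<Sum>i\<in>UNIV. \<Sum>j\<in>UNIV. A $ i $ k * B $ k $ j * C $ i $ j)"
    by (rule sum.swap)
  also have "\<dots> = (\<Sum>k\<in>UNIV. \<Sum>j\<in>UNIV. \<Sum>i\<in>UNIV. A $ i $ k * B $ k $ j * C $ i $ j)"
    by (intro sum.cong refl sum.swap)
  also have "\<dots> = B \<bullet> (transpose A ** C)"
    by (simp add: inner_matrix matrix_matrix_mult_def transpose_def sum_distrib_left mult_ac)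
  finally show ?thesis .
qed

lemma inner_matrix_mult_right:
  fixes A :: "real ^ 'k ^ 'm" and B :: "real ^ 'n ^ 'k" and C :: "real ^ 'n ^ 'm"
  shows "(A ** B) \<bullet> C = A \<bullet> (C ** transpose B)"
proof -
  have "(A ** B) \<bullet> C = (transpose B ** transpose A) \<bullet> transpose C"
    by (metis inner_transpose matrix_transpose_mul)
  also have "\<dots> = transpose A \<bullet> (B ** transpose C)"
    by (simp add: inner_matrix_mult_left)
  also have "\<dots> = A \<bullet> (C ** transpose B)"
    by (metis inner_transpose matrix_transpose_mul transpose_transpose)
  finally show ?thesis .
qed

lemma norm_matrix_vector_mult_le:
  fixes A :: "real ^ 'n ^ 'm"
  shows "norm (A *v x) \<le> norm A * norm x"
proof -
  have "(norm (A *v x))\<^sup>2 = (\<Sum>i\<in>UNIV. (A $ i \<bullet> x)\<^sup>2)"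
    by (simp add: norm_vec_def L2_set_def sum_nonneg matrix_vector_mul_component)
  also have "\<dots> \<le> (\<Sum>i\<in>UNIV. (norm (A $ i))\<^sup>2 * (norm x)\<^sup>2)"
    by (intro sum_mono) (metis Cauchy_Schwarz_ineq power2_norm_eq_inner)
  also have "\<dots> = (norm A * norm x)\<^sup>2"
    by (simp add: norm_vec_def[of A] L2_set_def sum_nonneg power_mult_distrib sum_distrib_right)
  finally show ?thesis
    by (rule power2_le_imp_le) simp
qed

lemma norm_matrix_columns:
  fixes A :: "real ^ 'n ^ 'm"
  shows "(norm A)\<^sup>2 = (\<Sum>j\<in>UNIV. (norm (column j A))\<^sup>2)"
proof -
  have "(norm A)\<^sup>2 = (norm (transpose A))\<^sup>2" by simp
  also have "\<dots> = (\<Sum>j\<in>UNIV. (norm (transpose A $ j))\<^sup>2)"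
    by (simp only: norm_vec_def[of "transpose A"]) (simp add: L2_set_def sum_nonneg)
  also have "\<dots> = (\<Sum>j\<in>UNIV. (norm (column j A))\<^sup>2)"
    by (simp add: column_def transpose_def)
  finally show ?thesis .
qed

lemma norm_matrix_mult_le_left:
  fixes A :: "real ^ 'k ^ 'm" and B :: "real ^ 'n ^ 'k"
  assumes "\<And>x. norm (A *v x) \<le> c * norm x" "0 \<le> c"
  shows "norm (A ** B) \<le> c * norm B"
proof -
  have col: "column j (A ** B) = A *v column j B" for j
    by (simp add: column_def matrix_matrix_mult_def matrix_vector_mult_def)
  have "(norm (A ** B))\<^sup>2 = (\<Sum>j\<in>UNIV. (norm (A *v column j B))\<^sup>2)"
    by (simp add: norm_matrix_columns col)
  also have "\<dots> \<le> (\<Sum>j\<in>UNIV. c\<^sup>2 * (norm (column j B))\<^sup>2)"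
    by (intro sum_mono) (metis assms(1) norm_ge_zero power_mono power_mult_distrib)
  also have "\<dots> = (c * norm B)\<^sup>2"
    by (simp add: norm_matrix_columns power_mult_distrib sum_distrib_left)
  finally show ?thesis
    by (rule power2_le_imp_le) (simp add: assms(2))
qed

lemma norm_matrix_mult_le:
  fixes A :: "real ^ 'k ^ 'm" and B :: "real ^ 'n ^ 'k"
  shows "norm (A ** B) \<le> norm A * norm B"
  by (intro norm_matrix_mult_le_left norm_matrix_vector_mult_le norm_ge_zero)

lemma norm_matrix_mult_le_right:
  fixes A :: "real ^ 'k ^ 'n" and B :: "real ^ 'k ^ 'm"
  assumes "\<And>x. norm (A *v x) \<le> c * norm x" "0 \<le> c"
  shows "norm (B ** transpose A) \<le> c * norm B"
proof -
  have "norm (B ** transpose A) = norm (A ** transpose B)"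
    by (metis matrix_transpose_mul norm_transpose transpose_transpose)
  then show ?thesis
    using norm_matrix_mult_le_left[OF assms, of "transpose B"] by simp
qed

lemma norm_transpose_vector_mult_le:
  fixes A :: "real ^ 'n ^ 'm"
  assumes "\<And>x. norm (A *v x) \<le> c * norm x" and c: "0 \<le> c"
  shows "norm (transpose A *v y) \<le> c * norm y"
proof -
  have "(norm (transpose A *v y))\<^sup>2 = y \<bullet> (A *v (transpose A *v y))"
    by (simp add: dot_lmul_matrix power2_norm_eq_inner)
  also have "\<dots> \<le> norm y * (c * norm (transpose A *v y))"
    by (rule order_trans[OF norm_cauchy_schwarz mult_left_mono[OF assms(1) norm_ge_zero]])
  finally have "norm (transpose A *v y) * norm (transpose A *v y)
      \<le> (c * norm y) * norm (transpose A *v y)"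
    by (simp add: power2_eq_square mult_ac)
  moreover have "0 \<le> c * norm y"
    using c by simp
  ultimately show ?thesis
    by (cases "norm (transpose A *v y) = 0") (auto simp: mult_le_cancel_right)
qed

lemma rank_add_le:
  fixes A B :: "real ^ 'n ^ 'm"
  shows "rank (A + B) \<le> rank A + rank B"
proof -
  let ?S = "range ((*v) A)" and ?T = "range ((*v) B)"
  have sub: "subspace ?S" "subspace ?T"
    by (auto intro!: linear_subspace_image)
  have "range ((*v) (A + B)) \<subseteq> {x + y |x y. x \<in> ?S \<and> y \<in> ?T}"
    by (auto simp: matrix_vector_mult_add_rdistrib)
  then have "rank (A + B) \<le> dim {x + y |x y. x \<in> ?S \<and> y \<in> ?T}"
    unfolding rank_dim_range by (rule dim_subset)
  also have "\<dots> \<le> rank A + rank B"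
    using dim_sums_Int[OF sub] by (simp add: rank_dim_range)
  finally show ?thesis .
qed

lemma rank_uminus [simp]: "rank (- A) = rank (A :: real ^ 'n ^ 'm)"
proof -
  have eq: "- A = A ** (- mat 1)" and eq': "A = (- A) ** (- mat 1)"
    by (simp_all add: vec_eq_iff matrix_matrix_mult_def mat_def sum_negf if_distrib cong: if_cong)
  have "rank (- A) \<le> rank A" by (subst eq) (rule rank_mul_le_left)
  moreover have "rank A \<le> rank (- A)" by (subst (1) eq') (rule rank_mul_le_left)
  ultimately show ?thesis by simp
qed

lemma rank_diff_le:
  fixes A B :: "real ^ 'n ^ 'm"
  shows "rank (A - B) \<le> rank A + rank B"
  using rank_add_le[of A "- B"] by simp

lemma rank_matrix_mult_le:
  fixes A :: "real ^ 'k ^ 'm" and B :: "real ^ 'n ^ 'k"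
  shows "rank (A ** B) \<le> CARD('k)"
  using rank_mul_le_left[of A B] rank_bound[of A] by simp

lemma bounded_bilinear_matrix_mult:
  "bounded_bilinear (\<lambda>(A :: real ^ 'k ^ 'm) (B :: real ^ 'n ^ 'k). A ** B)"
proof
  show "\<exists>K. \<forall>(A :: real ^ 'k ^ 'm) (B :: real ^ 'n ^ 'k). norm (A ** B) \<le> norm A * norm B * K"
    by (intro exI[of _ 1]) (simp add: norm_matrix_mult_le)
qed (simp_all add: vec_eq_iff matrix_matrix_mult_def algebra_simps sum.distrib sum_distrib_left)

lemmas matrix_mult_distribs =
  bounded_bilinear.add_left[OF bounded_bilinear_matrix_mult]
  bounded_bilinear.add_right[OF bounded_bilinear_matrix_mult]
  bounded_bilinear.diff_left[OF bounded_bilinear_matrix_mult]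
  bounded_bilinear.diff_right[OF bounded_bilinear_matrix_mult]

lemma transpose_add: "transpose (A + B) = transpose A + transpose (B :: real ^ 'n ^ 'm)"
  by (simp add: transpose_def vec_eq_iff)

lemma transpose_diff: "transpose (A - B) = transpose A - transpose (B :: real ^ 'n ^ 'm)"
  by (simp add: transpose_def vec_eq_iff)

lemma transpose_scaleR: "transpose (c *\<^sub>R A) = c *\<^sub>R transpose (A :: real ^ 'n ^ 'm)"
  by (simp add: transpose_def vec_eq_iff)

lemma orthogonal_projection_matrix_exists:
  fixes S :: "(real ^ 'n) set"
  assumes "subspace S"
  obtains P :: "real ^ 'n ^ 'n"
    where "transpose P = P" "P ** P = P" "range ((*v) P) = S"
proof -
  obtain B where B: "B \<subseteq> S" "pairwise orthogonal B" "\<And>x. x \<in> B \<Longrightarrow> norm x = 1"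
      "independent B" "span B = S"
    using orthonormal_basis_subspace[OF assms] by metis
  have fin: "finite B" using B(4) by (rule independent_imp_finite)
  define f where "f x = (\<Sum>b\<in>B. (x \<bullet> b) *\<^sub>R b)" for x
  have lin: "linear f"
    unfolding f_def by (intro linear_compose_sum ballI linearI)
      (auto simp: inner_add_left algebra_simps)
  have inS: "f x \<in> S" for x
    unfolding f_def using assms B(1) by (auto intro!: subspace_sum subspace_scale)
  have fb: "f b = b" if "b \<in> B" for b
  proof -
    have "f b = (\<Sum>c\<in>B. if c = b then b else 0)"
      unfolding f_def
    proof (intro sum.cong refl)
      fix c assume "c \<in> B"
      then show "(b \<bullet> c) *\<^sub>R c = (if c = b then b else 0)"
        using that B(2,3) by (auto simp: pairwise_def orthogonal_def norm_eq_1)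
    qed
    then show ?thesis using that fin by simp
  qed
  have fix_S: "f x = x" if "x \<in> S" for x
    by (rule linear_eq_on[OF lin linear_id[unfolded id_def], of x B]) (use that B fb in auto)
  define P where "P = matrix f"
  have P: "P *v x = f x" for x
    unfolding P_def using lin by (simp add: matrix_works)
  have "P ** P = P"
    by (simp add: matrix_eq matrix_vector_mul_assoc[symmetric] P fix_S inS)
  moreover have "range ((*v) P) = S"
  proof
    show "range ((*v) P) \<subseteq> S" using P inS by auto
    show "S \<subseteq> range ((*v) P)" using P fix_S by (metis rangeI subsetI)
  qed
  moreover have "transpose P = P"
  proof -
    have "x \<bullet> f y = f x \<bullet> y" for x y
      by (simp add: f_def inner_sum_left inner_sum_right inner_commute mult.commute)
    then have "(transpose P *v x) \<bullet> y = (P *v x) \<bullet> y" for x y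
      unfolding transpose_matrix_vector dot_lmul_matrix P .
    then have "transpose P *v x = P *v x" for x
      by (rule vector_eq_rdot[THEN iffD1, OF allI])
    then show ?thesis by (simp add: matrix_eq)
  qed
  ultimately show ?thesis using that by blast
qed

lemma norm_projection_vector_le:
  fixes P :: "real ^ 'n ^ 'n"
  assumes "transpose P = P" "P ** P = P"
  shows "norm (P *v x) \<le> norm x"
proof -
  have "(norm (P *v x))\<^sup>2 = x \<bullet> ((transpose P ** P) *v x)"
    unfolding power2_norm_eq_inner matrix_vector_mul_assoc[symmetric]
    by (metis dot_lmul_matrix inner_commute transpose_matrix_vector)
  also have "\<dots> = x \<bullet> (P *v x)" by (simp add: assms)
  also have "\<dots> \<le> norm x * norm (P *v x)" by (rule norm_cauchy_schwarz)
  finally show ?thesis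
    by (cases "norm (P *v x) = 0") (simp_all add: power2_eq_square)
qed

section \<open>Singular value decompositions\<close>

lemma bij_betw_pos: "bij_betw (pos :: 'n::finite \<Rightarrow> nat) UNIV {1..CARD('n::finite)}"
proof -
  have "bij_betw (to_nat_on (UNIV :: 'n set)) UNIV {..<CARD('n)}"
    by (rule to_nat_on_finite) simp
  moreover have "bij_betw Suc {..<CARD('n)} {1..CARD('n)}"
    by (rule bij_betwI[where g="\<lambda>x. x - 1"]) auto
  ultimately have "bij_betw (Suc \<circ> to_nat_on (UNIV :: 'n set)) UNIV {1..CARD('n)}"
    by (rule bij_betw_trans)
  then show ?thesis
    unfolding comp_def pos_def[abs_def] .
qed

lemma pos_eq_iff [simp]: "pos (i :: 'n::finite) = pos j \<longleftrightarrow> i = j"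
  using bij_betw_pos[where 'n='n] by (auto simp: bij_betw_def dest: injD)

lemma pos_range: "1 \<le> pos (i :: 'n::finite)" "pos (i :: 'n::finite) \<le> CARD('n::finite)"
  using bij_betw_apply[OF bij_betw_pos[where 'n='n], of i] by auto

lemma pos_surj:
  assumes "1 \<le> k" "k \<le> CARD('n::finite)"
  obtains i :: "'n::finite" where "pos i = k"
proof -
  have "k \<in> range (pos :: 'n \<Rightarrow> nat)"
    using bij_betw_imp_surj_on[OF bij_betw_pos[where 'n='n]] assms by simp
  then show ?thesis using that by blast
qed

lemma card_pos: "card {i :: 'n::finite. P (pos i)} = card {k \<in> {1..CARD('n::finite)}. P k}"
proof -
  have "{k \<in> {1..CARD('n)}. P k} = pos ` {i :: 'n. P (pos i)}"
    unfolding bij_betw_imp_surj_on[OF bij_betw_pos[where 'n='n], symmetric] by auto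
  moreover have "inj_on pos {i :: 'n. P (pos i)}"
    by (simp add: inj_on_def)
  ultimately show ?thesis by (simp add: card_image)
qed

text \<open>
  The cut-off is needed since the middle dimension may be smaller than both outer ones; indices beyond it have no
  partner in the sum.
\<close>

lemma rect_diag_mult:
  "(rect_diag a :: real ^ 'k ^ 'm) ** (rect_diag b :: real ^ 'n ^ 'k)
    = rect_diag (\<lambda>i. if i \<le> CARD('k) then a i * b i else 0)"
proof -
  have "(\<Sum>k\<in>(UNIV :: 'k set). (if pos i = pos k then a (pos i) else 0) * (if pos k = pos j then b (pos k) else 0))
      = (if pos i = pos j then if pos i \<le> CARD('k) then a (pos i) * b (pos i) else 0 else 0)"
    for i :: 'm and j :: 'n
  proof (cases "pos i \<le> CARD('k)")
    case True
    then obtain k0 :: 'k where k0: "pos k0 = pos i" using pos_range[of i] by (metis pos_surj)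
    have "(\<Sum>k\<in>(UNIV :: 'k set). (if pos i = pos k then a (pos i) else 0) * (if pos k = pos j then b (pos k) else 0))
        = (\<Sum>k\<in>UNIV. if k = k0 then (if pos i = pos j then a (pos i) * b (pos i) else 0) else 0)"
    proof (intro sum.cong refl)
      fix k :: 'k
      have "pos i = pos k \<longleftrightarrow> k = k0" unfolding k0[symmetric] by auto
      then show "(if pos i = pos k then a (pos i) else 0) * (if pos k = pos j then b (pos k) else 0)
          = (if k = k0 then (if pos i = pos j then a (pos i) * b (pos i) else 0) else 0)"
        by (auto simp: k0)
    qed
    then show ?thesis using True by simp
  next
    case False
    then have "pos i \<noteq> pos k" for k :: 'k using pos_range(2)[of k] by metis
    with False show ?thesis by simp
  qed
  then show ?thesis
    by (simp add: rect_diag_def matrix_matrix_mult_def vec_eq_iff)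
qed

lemma transpose_rect_diag [simp]: "transpose (rect_diag a :: real ^ 'n ^ 'm) = rect_diag a"
  by (simp add: rect_diag_def transpose_def vec_eq_iff)

lemma rect_diag_vector:
  "(rect_diag a :: real ^ 'n ^ 'n) *v x = (\<chi> i. a (pos i) * x $ i)"
  by (simp add: rect_diag_def matrix_vector_mult_def vec_eq_iff if_distrib[of "\<lambda>c. c * _"] cong: if_cong)

lemma norm_rect_diag_vector:
  assumes "\<And>i. CARD('m) < i \<Longrightarrow> a i = 0"
  shows "(norm ((rect_diag a :: real ^ 'n ^ 'm) *v x))\<^sup>2 = (\<Sum>j\<in>UNIV. (a (pos j))\<^sup>2 * (x $ j)\<^sup>2)"
proof -
  let ?D = "rect_diag a :: real ^ 'n ^ 'm"
  have "(norm (?D *v x))\<^sup>2 = x \<bullet> ((transpose ?D ** ?D) *v x)"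
    by (metis (no_types) dot_lmul_matrix inner_commute matrix_vector_mul_assoc power2_norm_eq_inner
        transpose_matrix_vector)
  also have "transpose ?D ** ?D = (rect_diag (\<lambda>i. (a i)\<^sup>2) :: real ^ 'n ^ 'n)"
    using assms by (simp add: rect_diag_mult) (intro arg_cong[where f=rect_diag] ext, auto simp: power2_eq_square)
  also have "x \<bullet> (\<dots> *v x) = (\<Sum>j\<in>UNIV. (a (pos j))\<^sup>2 * (x $ j)\<^sup>2)"
    by (simp add: rect_diag_vector inner_vec_def power2_eq_square mult_ac)
  finally show ?thesis .
qed

lemma norm_vec_square: "(norm (x :: real ^ 'n))\<^sup>2 = (\<Sum>j\<in>UNIV. (x $ j)\<^sup>2)"
  unfolding power2_norm_eq_inner inner_vec_def by (simp add: power2_eq_square)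

lemma norm_orthogonal_matrix_vector:
  assumes "orthogonal_matrix (U :: real ^ 'n ^ 'n)"
  shows "norm (U *v x) = norm x"
  using assms orthogonal_transformation_matrix[of "(*v) U"] orthogonal_transformation_norm by auto

lemma orthogonal_matrix_cancel:
  assumes "orthogonal_matrix (U :: real ^ 'n ^ 'n)"
  shows "transpose U ** U = mat 1" "U ** transpose U = mat 1"
  using assms by (simp_all add: orthogonal_matrix_def)

lemma norm_svd_vector:
  fixes X :: "real ^ 'n ^ 'm"
  assumes "is_svd U s V X"
  shows "(norm (X *v (V *v y)))\<^sup>2 = (\<Sum>j\<in>UNIV. (s (pos j))\<^sup>2 * (y $ j)\<^sup>2)"
proof -
  from assms have o: "orthogonal_matrix U" "orthogonal_matrix V"
    and X: "X = U ** rect_diag s ** transpose V" and s0: "\<And>i. CARD('m) < i \<Longrightarrow> s i = 0"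
    by (auto simp: is_svd_def)
  have "X ** V = U ** rect_diag s"
    unfolding X by (metis matrix_mul_assoc matrix_mul_rid o(2) orthogonal_matrix_cancel(1))
  then have "X *v (V *v y) = U *v (rect_diag s *v y)"
    by (metis matrix_vector_mul_assoc)
  then show ?thesis
    by (simp add: norm_orthogonal_matrix_vector[OF o(1)] norm_rect_diag_vector[OF s0])
qed

lemma svd_antimono:
  fixes X :: "real ^ 'n ^ 'm"
  assumes "is_svd U s V X" "1 \<le> i" "i \<le> j"
  shows "s j \<le> s i"
  using assms unfolding is_svd_def
  by (metis atLeastAtMost_iff order_trans)

text \<open>
  If \<open>s i\<close> exceeded \<open>s' i\<close>, then \<open>X\<close> would stretch the span of the first \<open>i\<close> columns of \<open>V\<close> by at least \<open>s i\<close>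
  and the span of the columns of \<open>V'\<close> from the \<open>i\<close>-th one on by at most \<open>s' i\<close>. The dimensions of the two spans add up
  to more than that of the whole space, so they share a nonzero vector, a contradiction. By symmetry, singular values do
  not depend on the decomposition.
\<close>

lemma svd_values_le:
  fixes X :: "real ^ 'n ^ 'm"
  assumes svd: "is_svd U s V X" and svd': "is_svd U' s' V' X" and i: "1 \<le> i"
  shows "s i \<le> s' i"
proof (rule ccontr)
  assume "\<not> s i \<le> s' i"
  then have less: "s' i < s i" by simp
  have nn: "0 \<le> s' k" "0 \<le> s k" for k using svd svd' by (auto simp: is_svd_def)
  have "i \<le> min CARD('m) CARD('n)"
    using less nn(1)[of i] svd unfolding is_svd_def by (metis atLeastAtMost_iff i not_le)
  then have i_le: "i \<le> CARD('n)" by simp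
  have o: "orthogonal_matrix V" "orthogonal_matrix V'"
    using svd svd' by (auto simp: is_svd_def)
  have inj: "inj_on ((*v) W) (span A)" if "orthogonal_matrix W" for W :: "real ^ 'n ^ 'n" and A
    by (rule inj_on_subset[of _ UNIV])
      (use that in \<open>auto intro!: inj_on_inverseI[where g="(*v) (transpose W)"]
        simp: matrix_vector_mul_assoc orthogonal_matrix_cancel\<close>)
  define A where "A = {y :: real ^ 'n. \<forall>j. j \<notin> {j. pos j \<le> i} \<longrightarrow> y $ j = 0}"
  define B where "B = {y :: real ^ 'n. \<forall>j. j \<notin> {j. i \<le> pos j} \<longrightarrow> y $ j = 0}"
  have "{k \<in> {1..CARD('n)}. k \<le> i} = {1..i}" "{k \<in> {1..CARD('n)}. i \<le> k} = {i..CARD('n)}"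
    using i i_le by auto
  then have "card {j :: 'n. pos j \<le> i} = i" "card {j :: 'n. i \<le> pos j} = Suc CARD('n) - i"
    using card_pos[of "\<lambda>k. k \<le> i", where 'n='n] card_pos[of "\<lambda>k. i \<le> k", where 'n='n] by simp_all
  moreover have "dim A = card {j :: 'n. pos j \<le> i}"
    unfolding A_def by (rule dim_substandard_cart[where 'a=real, unfolded dim_vec_eq])
  moreover have "dim B = card {j :: 'n. i \<le> pos j}"
    unfolding B_def by (rule dim_substandard_cart[where 'a=real, unfolded dim_vec_eq])
  ultimately have dimA: "dim A = i" and dimB: "dim B = Suc CARD('n) - i"
    by simp_all
  have subA: "subspace A" and subB: "subspace B"
    unfolding A_def B_def subspace_def by auto
  define S where "S = (*v) V ` A"
  define T where "T = (*v) V' ` B"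
  have sub: "subspace S" "subspace T"
    unfolding S_def T_def using subA subB by (auto intro!: linear_subspace_image)
  have dims: "dim S = i" "dim T = Suc CARD('n) - i"
    using dim_image_eq[OF matrix_vector_mul_linear inj[OF o(1)], of A]
      dim_image_eq[OF matrix_vector_mul_linear inj[OF o(2)], of B]
    unfolding S_def T_def dimA dimB .
  have "dim {x + y |x y. x \<in> S \<and> y \<in> T} \<le> CARD('n)"
    using dim_subset_UNIV_cart by blast
  then have "dim (S \<inter> T) \<noteq> 0"
    using dim_sums_Int[OF sub] dims i_le by linarith
  then have "\<not> S \<inter> T \<subseteq> {0}" by simp
  then obtain x where x: "x \<in> S" "x \<in> T" "x \<noteq> 0" by blast
  from x obtain y y' where y: "y \<in> A" "x = V *v y" and y': "y' \<in> B" "x = V' *v y'"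
    by (auto simp: S_def T_def)
  have ny: "norm y = norm x" and ny': "norm y' = norm x"
    using norm_orthogonal_matrix_vector[OF o(1), of y] norm_orthogonal_matrix_vector[OF o(2), of y']
      y(2) y'(2) by simp_all
  have "(s i)\<^sup>2 * (norm x)\<^sup>2 = (\<Sum>j\<in>UNIV. (s i)\<^sup>2 * (y $ j)\<^sup>2)"
    by (simp add: ny[symmetric] norm_vec_square sum_distrib_left)
  also have "\<dots> \<le> (\<Sum>j\<in>UNIV. (s (pos j))\<^sup>2 * (y $ j)\<^sup>2)"
  proof (rule sum_mono)
    fix j :: 'n
    show "(s i)\<^sup>2 * (y $ j)\<^sup>2 \<le> (s (pos j))\<^sup>2 * (y $ j)\<^sup>2"
    proof (cases "pos j \<le> i")
      case True
      then show ?thesis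
        using svd_antimono[OF svd pos_range(1) True] nn by (intro mult_right_mono power_mono) auto
    next
      case False
      then show ?thesis using y(1) by (simp add: A_def)
    qed
  qed
  also have "\<dots> = (norm (X *v x))\<^sup>2" by (simp add: y(2) norm_svd_vector[OF svd])
  also have "\<dots> = (\<Sum>j\<in>UNIV. (s' (pos j))\<^sup>2 * (y' $ j)\<^sup>2)"
    by (simp add: y'(2) norm_svd_vector[OF svd'])
  also have "\<dots> \<le> (\<Sum>j\<in>UNIV. (s' i)\<^sup>2 * (y' $ j)\<^sup>2)"
  proof (rule sum_mono)
    fix j :: 'n
    show "(s' (pos j))\<^sup>2 * (y' $ j)\<^sup>2 \<le> (s' i)\<^sup>2 * (y' $ j)\<^sup>2"
    proof (cases "i \<le> pos j")
      case True
      then show ?thesis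
        using svd_antimono[OF svd' i True] nn by (intro mult_right_mono power_mono) auto
    next
      case False
      then show ?thesis using y'(1) by (simp add: B_def)
    qed
  qed
  also have "\<dots> = (s' i)\<^sup>2 * (norm x)\<^sup>2"
    by (simp add: ny'[symmetric] norm_vec_square sum_distrib_left)
  finally have "(s i)\<^sup>2 \<le> (s' i)\<^sup>2"
    using x(3) by (simp add: mult_le_cancel_right)
  then have "s i \<le> s' i" by (rule power2_le_imp_le) (rule nn)
  then show False using less by simp
qed

lemma singular_value_eq:
  fixes X :: "real ^ 'n ^ 'm"
  assumes svd: "is_svd U s V X"
  shows "singular_value i X = s i"
proof -
  have "s' i = s i" if "is_svd U' s' V' X" for U' s' V'
  proof (cases "1 \<le> i")
    case True
    then show ?thesis using svd_values_le[OF svd that] svd_values_le[OF that svd] by fastforce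
  next
    case False
    then show ?thesis using svd that by (simp add: is_svd_def)
  qed
  then show ?thesis
    unfolding singular_value_def using svd by (intro the_equality) blast+
qed

lemma rank_svd:
  fixes X :: "real ^ 'n ^ 'm"
  assumes svd: "is_svd U s V X"
  shows "rank X = card {k \<in> {1..CARD('m)}. s k \<noteq> 0}"
proof -
  from svd have o: "orthogonal_matrix U" "orthogonal_matrix V"
    and X: "X = U ** rect_diag s ** transpose V"
    and s0: "\<And>i. CARD('n) < i \<Longrightarrow> s i = 0"
    by (auto simp: is_svd_def)
  let ?D = "rect_diag s :: real ^ 'n ^ 'm"
  have D: "?D = transpose U ** (X ** V)"
    unfolding X by (metis matrix_mul_assoc matrix_mul_lid matrix_mul_rid o orthogonal_matrix_cancel(1))
  have "rank X \<le> rank ?D"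
    unfolding X by (meson rank_mul_le_left rank_mul_le_right order_trans)
  moreover have "rank ?D \<le> rank X"
    unfolding D by (meson rank_mul_le_left rank_mul_le_right order_trans)
  ultimately have "rank X = dim (range ((*v) ?D))"
    by (simp add: rank_dim_range)
  also have "range ((*v) ?D) = {x. \<forall>i. i \<notin> {i. s (pos i) \<noteq> 0} \<longrightarrow> x $ i = 0}"
  proof (intro subset_antisym subsetI)
    fix x assume "x \<in> range ((*v) ?D)"
    then show "x \<in> {x. \<forall>i. i \<notin> {i. s (pos i) \<noteq> 0} \<longrightarrow> x $ i = 0}"
      by (auto simp: rect_diag_def matrix_vector_mult_def intro!: sum.neutral)
  next
    fix x :: "real ^ 'm" assume x: "x \<in> {x. \<forall>i. i \<notin> {i. s (pos i) \<noteq> 0} \<longrightarrow> x $ i = 0}"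
    have "?D *v ((rect_diag (\<lambda>i. inverse (s i)) :: real ^ 'm ^ 'n) *v x)
        = (rect_diag (\<lambda>i. if i \<le> CARD('n) then s i * inverse (s i) else 0) :: real ^ 'm ^ 'm) *v x"
      by (simp add: matrix_vector_mul_assoc rect_diag_mult)
    also have "\<dots> = x"
    proof -
      have "(if pos i \<le> CARD('n) then s (pos i) * inverse (s (pos i)) else 0) * x $ i = x $ i" for i
        using x s0[of "pos i"] by (cases "s (pos i) = 0") (auto simp: not_le)
      then show ?thesis by (simp only: rect_diag_vector vec_eq_iff vec_lambda_beta) simp
    qed
    finally show "x \<in> range ((*v) ?D)" by (metis rangeI)
  qed
  finally show ?thesis
    unfolding dim_substandard_cart[where 'a=real, unfolded dim_vec_eq]
      card_pos[of "\<lambda>k. s k \<noteq> 0"] .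
qed

lemma downward_closed_eq_interval:
  fixes N :: "nat set"
  assumes fin: "finite N" and pos: "\<And>i. i \<in> N \<Longrightarrow> 1 \<le> i"
    and down: "\<And>i j. i \<in> N \<Longrightarrow> 1 \<le> j \<Longrightarrow> j \<le> i \<Longrightarrow> j \<in> N"
  shows "N = {1..card N}"
proof (cases "N = {}")
  case False
  obtain m where m: "m = Max N" by simp
  have "N = {1..m}"
  proof (intro subset_antisym subsetI)
    fix j assume "j \<in> N" then show "j \<in> {1..m}" using fin pos by (simp add: m)
  next
    fix j assume "j \<in> {1..m}"
    then show "j \<in> N" using down[OF Max_in[OF fin False], of j] by (simp add: m)
  qed
  then show ?thesis by simp
qed simp

text \<open>
  The rank counts the nonzero diagonal entries, and as the entries are nonincreasing these come first.
\<close>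

lemma svd_nonzero_iff:
  fixes X :: "real ^ 'n ^ 'm"
  assumes svd: "is_svd U s V X" and r: "rank X = r"
  shows "s i \<noteq> 0 \<longleftrightarrow> i \<in> {1..r}"
proof -
  let ?N = "{k \<in> {1..CARD('m)}. s k \<noteq> 0}"
  have N: "i \<in> ?N \<longleftrightarrow> s i \<noteq> 0" for i
    using svd by (auto simp: is_svd_def)
  have down: "j \<in> ?N" if "i \<in> ?N" "1 \<le> j" "j \<le> i" for i j
  proof -
    have "0 < s i" using that svd by (auto simp: is_svd_def less_le)
    also have "s i \<le> s j" using svd_antimono[OF svd that(2,3)] .
    finally show ?thesis using N by auto
  qed
  have "?N = {1..r}"
  proof -
    have "?N = {1..card ?N}"
      by (rule downward_closed_eq_interval) (use down in auto)
    then show ?thesis unfolding rank_svd[OF svd, symmetric] r .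
  qed
  then show ?thesis using N by blast
qed

text \<open>
  For orthogonal \<open>V\<close>, the orthogonal projection onto the span of its first \<open>k\<close> columns. For \<open>k\<close> the rank of \<open>X = U \<Sigma> V\<^sup>T\<close> it
  is \<open>X\<^sup>+ X\<close>, which depends on \<open>X\<close> only through \<open>V\<close> and the rank; this is how matching right singular vectors
  enter.
\<close>

definition truncation :: "nat \<Rightarrow> real ^ 'n ^ 'n \<Rightarrow> real ^ 'n ^ 'n" where
  "truncation k V = V ** rect_diag (\<lambda>i. if i \<le> k then 1 else 0) ** transpose V"

text \<open>
  The last bound is generous: the norm is the square root of the right-hand side, which is at most the right-hand side
  because that is a natural number.
\<close>

lemma truncation_properties:
  fixes V :: "real ^ 'n ^ 'n"
  assumes V: "orthogonal_matrix V" and k: "k \<le> CARD('n)"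
  shows "transpose (truncation k V) = truncation k V"
    and "truncation k V ** truncation k V = truncation k V"
    and "norm (mat 1 - truncation k V) \<le> real (CARD('n) - k)"
proof -
  let ?J = "rect_diag (\<lambda>i. if i \<le> k then 1 else 0) :: real ^ 'n ^ 'n"
  let ?K = "rect_diag (\<lambda>i. if i \<le> k then 0 else 1) :: real ^ 'n ^ 'n"
  note c = orthogonal_matrix_cancel[OF V]
  show "transpose (truncation k V) = truncation k V"
    by (simp add: truncation_def matrix_transpose_mul matrix_mul_assoc)
  have "?J ** ?J = ?J"
    using k by (simp add: rect_diag_mult) (intro arg_cong[where f=rect_diag] ext, auto)
  moreover have "truncation k V ** truncation k V = V ** (?J ** (transpose V ** V) ** ?J) ** transpose V"
    by (simp add: truncation_def matrix_mul_assoc)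
  ultimately show "truncation k V ** truncation k V = truncation k V"
    by (simp add: c truncation_def)
  have "mat 1 - truncation k V = V ** (mat 1 - ?J) ** transpose V"
    by (simp add: truncation_def matrix_mult_distribs c)
  also have "mat 1 - ?J = ?K"
    by (simp add: rect_diag_def mat_def vec_eq_iff)
  finally have "norm (mat 1 - truncation k V) = norm (V ** ?K ** transpose V)" by simp
  also have "\<dots> \<le> 1 * norm (V ** ?K)"
    by (rule norm_matrix_mult_le_right) (simp_all add: norm_orthogonal_matrix_vector V)
  also have "\<dots> \<le> 1 * (1 * norm ?K)"
    by (intro mult_left_mono norm_matrix_mult_le_left) (simp_all add: norm_orthogonal_matrix_vector V)
  also have "norm ?K \<le> real (CARD('n) - k)"
  proof (rule power2_le_imp_le)
    have "(norm ?K)\<^sup>2 = (\<Sum>i\<in>(UNIV::'n set). if k < pos i then 1 else 0)"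
      by (simp add: power2_norm_eq_inner inner_matrix rect_diag_def if_distrib[of "\<lambda>c. c * _"] not_le cong: if_cong)
        (intro sum.cong, auto)
    also have "\<dots> = real (card {i :: 'n. k < pos i})"
      by (simp add: sum.If_cases)
    also have "card {i :: 'n. k < pos i} = card {j \<in> {1..CARD('n)}. k < j}"
      by (rule card_pos)
    also have "{j \<in> {1..CARD('n)}. k < j} = {k<..CARD('n)}" by auto
    also have "real (card {k<..CARD('n)}) \<le> (real (CARD('n) - k))\<^sup>2"
      by (cases "CARD('n) - k") (auto simp: power2_eq_square algebra_simps)
    finally show "(norm ?K)\<^sup>2 \<le> (real (CARD('n) - k))\<^sup>2" .
  qed simp
  finally show "norm (mat 1 - truncation k V) \<le> real (CARD('n) - k)" by simp
qed

text \<open>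
  \<open>L\<close> is the Moore--Penrose inverse \<open>V \<Sigma>\<^sup>+ U\<^sup>T\<close>. The convention \<open>inverse 0 = 0\<close> makes \<open>\<Sigma>\<^sup>+\<close> the entrywise
  inverse of \<open>\<Sigma>\<close>.
\<close>

lemma svd_left_inverse:
  fixes X :: "real ^ 'n ^ 'm"
  assumes svd: "is_svd U s V X" and r: "rank X = k" "1 \<le> k"
  obtains L :: "real ^ 'm ^ 'n"
    where "L ** X = truncation k V" "X ** truncation k V = X"
      "\<And>x. norm (L *v x) \<le> 1 / s k * norm x"
proof -
  from svd have o: "orthogonal_matrix U" "orthogonal_matrix V"
    and X: "X = U ** rect_diag s ** transpose V"
    and s0: "\<And>i. CARD('m) < i \<Longrightarrow> s i = 0" and s0': "\<And>i. CARD('n) < i \<Longrightarrow> s i = 0"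
    and nn: "\<And>i. 0 \<le> s i"
    by (auto simp: is_svd_def)
  note c = orthogonal_matrix_cancel[OF o(1)] orthogonal_matrix_cancel[OF o(2)]
  note nz = svd_nonzero_iff[OF svd r(1)]
  have k: "0 < s k" using nz[of k] nn[of k] r(2) by auto
  define L where "L = V ** (rect_diag (\<lambda>i. inverse (s i)) :: real ^ 'm ^ 'n) ** transpose U"
  have "L ** X = V ** ((rect_diag (\<lambda>i. inverse (s i)) :: real ^ 'm ^ 'n) ** (transpose U ** U)
      ** rect_diag s) ** transpose V"
    by (simp add: L_def X matrix_mul_assoc)
  also have "\<dots> = V ** ((rect_diag (\<lambda>i. inverse (s i)) :: real ^ 'm ^ 'n) ** rect_diag s) ** transpose V"
    by (simp add: c)
  also have "(rect_diag (\<lambda>i. inverse (s i)) :: real ^ 'm ^ 'n) ** rect_diag s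
      = (rect_diag (\<lambda>i. if i \<le> k then 1 else 0) :: real ^ 'n ^ 'n)"
  proof -
    have "(if i \<le> CARD('m) then inverse (s i) * s i else 0) = (if i \<le> k then 1 else 0)"
      if "1 \<le> i" for i
      using nz[of i] s0[of i] that by (cases "s i = 0") (auto simp: not_le)
    note aux = this[OF pos_range(1)[where 'n='n]]
    show ?thesis
      unfolding rect_diag_mult
      by (simp only: rect_diag_def vec_eq_iff vec_lambda_beta aux) simp
  qed
  finally have LX: "L ** X = truncation k V" by (simp add: truncation_def)
  have "X ** truncation k V = U ** (rect_diag s ** (transpose V ** V)
      ** rect_diag (\<lambda>i. if i \<le> k then 1 else 0)) ** transpose V"
    by (simp add: truncation_def X matrix_mul_assoc)
  also have "\<dots> = U ** (rect_diag s ** (rect_diag (\<lambda>i. if i \<le> k then 1 else 0) :: real ^ 'n ^ 'n)) ** transpose V"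
    by (simp add: c)
  also have "rect_diag s ** (rect_diag (\<lambda>i. if i \<le> k then 1 else 0) :: real ^ 'n ^ 'n)
      = (rect_diag s :: real ^ 'n ^ 'm)"
    unfolding rect_diag_mult
  proof (intro arg_cong[where f=rect_diag] ext)
    fix i
    show "(if i \<le> CARD('n) then s i * (if i \<le> k then 1 else 0) else 0) = s i"
      using nz[of i] s0'[of i] by (cases "s i = 0") (auto simp: not_le)
  qed
  finally have XJ: "X ** truncation k V = X" by (simp add: X)
  have "norm (L *v x) \<le> 1 / s k * norm x" for x
  proof (rule power2_le_imp_le)
    have "(norm (L *v x))\<^sup>2 = (norm ((rect_diag (\<lambda>i. inverse (s i)) :: real ^ 'm ^ 'n) *v (transpose U *v x)))\<^sup>2"
      by (simp add: L_def matrix_vector_mul_assoc[symmetric] norm_orthogonal_matrix_vector o)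
    also have "\<dots> = (\<Sum>j\<in>UNIV. (inverse (s (pos j)))\<^sup>2 * ((transpose U *v x) $ j)\<^sup>2)"
      by (rule norm_rect_diag_vector) (simp add: s0')
    also have "\<dots> \<le> (\<Sum>j\<in>UNIV. (1 / s k)\<^sup>2 * ((transpose U *v x) $ j)\<^sup>2)"
    proof (intro sum_mono mult_right_mono power_mono)
      fix j :: 'm
      show "inverse (s (pos j)) \<le> 1 / s k"
      proof (cases "s (pos j) = 0")
        case False
        then have "pos j \<le> k" using nz by auto
        then have "s k \<le> s (pos j)" using svd_antimono[OF svd pos_range(1)] by blast
        then show ?thesis using k by (simp add: inverse_eq_divide frac_le)
      qed (use k in simp)
    qed (simp_all add: nn)
    also have "\<dots> = (1 / s k * norm x)\<^sup>2"
      unfolding sum_distrib_left[symmetric] norm_vec_square[symmetric]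
      using norm_orthogonal_matrix_vector[of "transpose U" x] o(1)
      by (simp add: power_mult_distrib power_divide)
    finally show "(norm (L *v x))\<^sup>2 \<le> (1 / s k * norm x)\<^sup>2" .
  qed (use k in simp)
  then show ?thesis using that LX XJ by blast
qed

section \<open>The residual of the damped projection\<close>

text \<open>
  The hypothesis \<open>res\<close> says that \<open>p = e - D t\<close> for the damped least squares solution \<open>t\<close>. Its inner product with \<open>p\<close>
  is the energy identity, which shows that \<open>e - p\<close> and \<open>p\<close> form an acute angle. The middle estimate is the key
  one: with \<open>a = p Y Y\<^sup>T\<close> and \<open>b = X X\<^sup>T p\<close> one has \<open>\<langle>a, b\<rangle> = \<parallel>X\<^sup>T p Y\<parallel>\<^sup>2\<close>, while
  \<open>4 \<langle>a, b\<rangle> \<le> \<parallel>a + b\<parallel>\<^sup>2 = \<lambda>\<^sup>2 \<parallel>e - p\<parallel>\<^sup>2\<close>. It is uniform in the singular values of \<open>X\<close> and \<open>Y\<close>.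
\<close>

lemma damped_identities:
  fixes X :: "real ^ 'r ^ 'd1" and Y :: "real ^ 'r ^ 'd2" and e p :: "real ^ 'd2 ^ 'd1"
  assumes lam: "0 < lam"
    and res: "lam *\<^sub>R (e - p) = p ** Y ** transpose Y + X ** (transpose X ** p)"
  shows "lam * (e \<bullet> p) = lam * (norm p)\<^sup>2 + (norm (p ** Y))\<^sup>2 + (norm (transpose X ** p))\<^sup>2"
    and "norm (transpose X ** p ** Y) \<le> lam * norm e / 2"
    and "norm p \<le> norm e"
proof -
  have "lam * ((e - p) \<bullet> p) = (norm (p ** Y))\<^sup>2 + (norm (transpose X ** p))\<^sup>2"
  proof -
    have "lam * ((e - p) \<bullet> p) = (p ** Y ** transpose Y) \<bullet> p + (X ** (transpose X ** p)) \<bullet> p"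
      by (simp only: inner_scaleR_left[symmetric] res inner_add_left)
    also have "(p ** Y ** transpose Y) \<bullet> p = (norm (p ** Y))\<^sup>2"
      by (simp add: inner_matrix_mult_right power2_norm_eq_inner)
    also have "(X ** (transpose X ** p)) \<bullet> p = (norm (transpose X ** p))\<^sup>2"
      by (simp add: inner_matrix_mult_left power2_norm_eq_inner)
    finally show ?thesis .
  qed
  note energy = this
  then show "lam * (e \<bullet> p) = lam * (norm p)\<^sup>2 + (norm (p ** Y))\<^sup>2 + (norm (transpose X ** p))\<^sup>2"
    by (simp add: inner_diff_left algebra_simps power2_norm_eq_inner)
  have pos: "0 \<le> (e - p) \<bullet> p"
    using energy lam zero_le_mult_iff[of lam "(e - p) \<bullet> p"] by simp
  have "(norm e)\<^sup>2 = (norm (e - p))\<^sup>2 + 2 * ((e - p) \<bullet> p) + (norm p)\<^sup>2"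
    by (simp add: power2_norm_eq_inner inner_diff inner_commute)
  then have ep2: "(norm (e - p))\<^sup>2 \<le> (norm e)\<^sup>2" and p2: "(norm p)\<^sup>2 \<le> (norm e)\<^sup>2"
    using pos by auto
  from ep2 have ep: "norm (e - p) \<le> norm e"
    by (rule power2_le_imp_le) simp
  show "norm p \<le> norm e"
    using p2 by (rule power2_le_imp_le) simp
  let ?a = "p ** Y ** transpose Y" and ?b = "X ** (transpose X ** p)"
  have "?b \<bullet> ?a = (transpose X ** p) \<bullet> (transpose X ** ?a)"
    by (rule inner_matrix_mult_left)
  also have "\<dots> = (transpose X ** p) \<bullet> (transpose X ** p ** Y ** transpose Y)"
    by (simp add: matrix_mul_assoc)
  also have "\<dots> = (norm (transpose X ** p ** Y))\<^sup>2"
    by (metis inner_commute inner_matrix_mult_right power2_norm_eq_inner transpose_transpose)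
  finally have ab: "?a \<bullet> ?b = (norm (transpose X ** p ** Y))\<^sup>2"
    by (simp add: inner_commute)
  have "4 * (?a \<bullet> ?b) \<le> (norm (?a + ?b))\<^sup>2"
  proof -
    have "(norm (?a + ?b))\<^sup>2 = 4 * (?a \<bullet> ?b) + (norm (?a - ?b))\<^sup>2"
      by (simp add: power2_norm_eq_inner inner_diff inner_add inner_commute)
    then show ?thesis by simp
  qed
  also have "norm (?a + ?b) = lam * norm (e - p)"
    using lam res by (metis abs_of_pos norm_scaleR)
  also have "(lam * norm (e - p))\<^sup>2 \<le> (lam * norm e)\<^sup>2"
    using lam ep by (intro power_mono mult_left_mono) auto
  finally have "(norm (transpose X ** p ** Y))\<^sup>2 \<le> (lam * norm e / 2)\<^sup>2"
    by (simp add: ab power_divide)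
  then show "norm (transpose X ** p ** Y) \<le> lam * norm e / 2"
    by (rule power2_le_imp_le) (use lam in simp)
qed

text \<open>
  Expand \<open>Z N Z = Z\<close> for \<open>N = M\<^sup>T L\<close> after the substitution \<open>Z = X Y\<^sup>T - e\<close>. In the first term \<open>X\<close> and \<open>Y\<close> stand
  on the outside, the second and third are linear in \<open>e\<close> but contain \<open>Y\<^sup>T\<close> or \<open>X\<close>, and only the last one
  need not lie in the range of the derivative of the factorization map.
\<close>

lemma error_decomposition:
  fixes X :: "real ^ 'r ^ 'd1" and Y :: "real ^ 'r ^ 'd2" and Z :: "real ^ 'd2 ^ 'd1"
    and L :: "real ^ 'd1 ^ 'r" and M :: "real ^ 'd2 ^ 'r"
  assumes e: "e = X ** transpose Y - Z"
    and ginv: "Z ** transpose M ** L ** Z = Z"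
  shows "e = X ** (mat 1 - transpose (M ** Y) ** (L ** X)) ** transpose Y
        + e ** transpose M ** (L ** X) ** transpose Y
        + X ** (transpose (M ** Y) ** L ** e) - e ** transpose M ** (L ** e)"
proof -
  let ?P = "X ** transpose Y" and ?N = "transpose M ** L"
  have Z: "Z = ?P - e" using e by simp
  have "(?P - e) ** ?N ** (?P - e) = ?P - e"
    using ginv unfolding Z by (simp add: matrix_mul_assoc)
  then have "e = ?P - ?P ** ?N ** ?P + e ** ?N ** ?P + ?P ** ?N ** e - e ** ?N ** e"
    by (simp add: matrix_mult_distribs algebra_simps)
  then show ?thesis
    by (simp add: matrix_mult_distribs matrix_transpose_mul matrix_mul_assoc)
qed

text \<open>
  Each of the four terms of \<open>error_decomposition\<close> is paired with \<open>p\<close>. The terms in \<open>\<parallel>p Y\<parallel>\<close> and \<open>\<parallel>X\<^sup>T p\<parallel>\<close> are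
  split by Young's inequality so that their squares cancel against the energy identity.
\<close>

lemma damped_residual_bound:
  fixes X :: "real ^ 'r ^ 'd1" and Y :: "real ^ 'r ^ 'd2" and Z :: "real ^ 'd2 ^ 'd1"
    and L :: "real ^ 'd1 ^ 'r" and M :: "real ^ 'd2 ^ 'r"
  assumes lam: "0 < lam"
    and e: "e = X ** transpose Y - Z"
    and res: "lam *\<^sub>R (e - p) = p ** Y ** transpose Y + X ** (transpose X ** p)"
    and ginv: "Z ** transpose M ** L ** Z = Z"
    and L: "\<And>x. norm (L *v x) \<le> l * norm x" and M: "\<And>x. norm (M *v x) \<le> l * norm x"
    and l: "0 \<le> l"
    and LX: "\<And>x. norm ((L ** X) *v x) \<le> a * norm x"
    and MY: "\<And>x. norm ((M ** Y) *v x) \<le> a * norm x"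
    and a: "0 \<le> a"
    and c: "norm (mat 1 - transpose (M ** Y) ** (L ** X)) \<le> c"
  shows "(norm p)\<^sup>2 \<le> c * lam * norm e / 2 + lam * (a * l * norm e)\<^sup>2 / 2 + l\<^sup>2 * (norm e) ^ 3"
proof -
  let ?C = "mat 1 - transpose (M ** Y) ** (L ** X)"
  note id = damped_identities[OF lam res]
  have young: "b * x \<le> x\<^sup>2 / lam + lam * b\<^sup>2 / 4" for b x :: real
  proof -
    have "0 \<le> (x - lam * b / 2)\<^sup>2 / lam" using lam by simp
    also have "\<dots> = x\<^sup>2 / lam + lam * b\<^sup>2 / 4 - b * x"
      using lam by (simp add: field_simps power2_eq_square)
    finally show ?thesis by simp
  qed
  define s where "s = a * l * norm e"
  have split: "e \<bullet> p = (X ** ?C ** transpose Y) \<bullet> p + (e ** transpose M ** (L ** X) ** transpose Y) \<bullet> p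
      + (X ** (transpose (M ** Y) ** L ** e)) \<bullet> p - (e ** transpose M ** (L ** e)) \<bullet> p"
    by (subst error_decomposition[OF e ginv]) (simp only: inner_add_left inner_diff_left)
  have t1: "(X ** ?C ** transpose Y) \<bullet> p \<le> c * (lam * norm e / 2)"
  proof -
    have "(X ** ?C ** transpose Y) \<bullet> p = (X ** ?C) \<bullet> (p ** Y)"
      by (subst inner_matrix_mult_right) simp
    also have "\<dots> = ?C \<bullet> (transpose X ** (p ** Y))"
      by (rule inner_matrix_mult_left)
    also have "\<dots> = ?C \<bullet> (transpose X ** p ** Y)"
      by (simp add: matrix_mul_assoc)
    also have "\<dots> \<le> norm ?C * norm (transpose X ** p ** Y)" by (rule norm_cauchy_schwarz)
    also have "\<dots> \<le> c * (lam * norm e / 2)"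
      using c id(2) by (intro mult_mono) (auto intro: order_trans[OF norm_ge_zero])
    finally show ?thesis .
  qed
  have t2: "(e ** transpose M ** (L ** X) ** transpose Y) \<bullet> p \<le> s * norm (p ** Y)"
  proof -
    have "norm (e ** transpose M ** (L ** X)) \<le> a * norm (e ** transpose M)"
      using norm_matrix_mult_le_right[OF norm_transpose_vector_mult_le[OF LX a] a, of "e ** transpose M"]
      by simp
    also have "\<dots> \<le> a * (l * norm e)"
      by (intro mult_left_mono norm_matrix_mult_le_right M l a)
    finally have bound: "norm (e ** transpose M ** (L ** X)) \<le> s" by (simp add: s_def mult_ac)
    have eq: "(e ** transpose M ** (L ** X) ** transpose Y) \<bullet> p
        = (e ** transpose M ** (L ** X)) \<bullet> (p ** Y)"
      by (simp add: inner_matrix_mult_right[where B="transpose Y"])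
    show ?thesis
      unfolding eq by (rule order_trans[OF norm_cauchy_schwarz mult_right_mono[OF bound norm_ge_zero]])
  qed
  have t3: "(X ** (transpose (M ** Y) ** L ** e)) \<bullet> p \<le> s * norm (transpose X ** p)"
  proof -
    have "norm (transpose (M ** Y) ** L ** e) \<le> a * norm (L ** e)"
      using norm_matrix_mult_le_left[OF norm_transpose_vector_mult_le[OF MY a] a, of "L ** e"]
      by (simp add: matrix_mul_assoc)
    also have "\<dots> \<le> a * (l * norm e)"
      by (intro mult_left_mono norm_matrix_mult_le_left L l a)
    finally have bound: "norm (transpose (M ** Y) ** L ** e) \<le> s" by (simp add: s_def mult_ac)
    have eq: "(X ** (transpose (M ** Y) ** L ** e)) \<bullet> p
        = (transpose (M ** Y) ** L ** e) \<bullet> (transpose X ** p)"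
      by (rule inner_matrix_mult_left)
    show ?thesis
      unfolding eq by (rule order_trans[OF norm_cauchy_schwarz mult_right_mono[OF bound norm_ge_zero]])
  qed
  have t4: "- ((e ** transpose M ** (L ** e)) \<bullet> p) \<le> l\<^sup>2 * norm e ^ 3"
  proof -
    have "norm (e ** transpose M ** (L ** e)) \<le> norm (e ** transpose M) * norm (L ** e)"
      by (rule norm_matrix_mult_le)
    also have "\<dots> \<le> (l * norm e) * (l * norm e)"
      by (intro mult_mono norm_matrix_mult_le_right norm_matrix_mult_le_left M L l) (auto simp: l)
    finally have *: "norm (e ** transpose M ** (L ** e)) \<le> l\<^sup>2 * (norm e)\<^sup>2"
      by (simp add: power2_eq_square mult_ac)
    have "- ((e ** transpose M ** (L ** e)) \<bullet> p) \<le> norm (e ** transpose M ** (L ** e)) * norm p"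
      using Cauchy_Schwarz_ineq2[of "e ** transpose M ** (L ** e)" p] by linarith
    also have "\<dots> \<le> (l\<^sup>2 * (norm e)\<^sup>2) * norm e"
      using * id(3) by (intro mult_mono) auto
    finally show ?thesis by (simp add: power3_eq_cube power2_eq_square mult_ac)
  qed
  have energy: "e \<bullet> p = (norm p)\<^sup>2 + (norm (p ** Y))\<^sup>2 / lam + (norm (transpose X ** p))\<^sup>2 / lam"
  proof -
    have "e \<bullet> p = (lam * (e \<bullet> p)) / lam" using lam by simp
    then show ?thesis unfolding id(1) using lam by (simp add: add_divide_distrib)
  qed
  have "e \<bullet> p \<le> c * (lam * norm e / 2) + s * norm (p ** Y)
      + s * norm (transpose X ** p) + l\<^sup>2 * norm e ^ 3"
    using split t1 t2 t3 t4 by linarith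
  also have "\<dots> \<le> c * (lam * norm e / 2) + ((norm (p ** Y))\<^sup>2 / lam + lam * s\<^sup>2 / 4)
      + ((norm (transpose X ** p))\<^sup>2 / lam + lam * s\<^sup>2 / 4) + l\<^sup>2 * norm e ^ 3"
    by (intro add_mono young order_refl)
  finally show ?thesis
    unfolding energy s_def[symmetric] by simp
qed

text \<open>
  \<open>L X\<close> and \<open>M Y\<close> differ from the projection \<open>Q\<close> by matrices of norm at most \<open>k\<close>, so \<open>(M Y)\<^sup>T (L X)\<close>, which is
  \<open>Y\<^sup>T N X\<close> for \<open>N = M\<^sup>T L\<close>, is close to \<open>Q\<close> itself.
\<close>

lemma perturbed_left_inverse_bounds:
  fixes X Xs :: "real ^ 'r ^ 'd1" and Y Ys :: "real ^ 'r ^ 'd2"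
    and L :: "real ^ 'd1 ^ 'r" and M :: "real ^ 'd2 ^ 'r" and Q :: "real ^ 'r ^ 'r"
  assumes LXs: "L ** Xs = Q" and MYs: "M ** Ys = Q"
    and Q: "transpose Q = Q" "Q ** Q = Q" "\<And>x. norm (Q *v x) \<le> norm x"
    and L: "\<And>x. norm (L *v x) \<le> l * norm x" and M: "\<And>x. norm (M *v x) \<le> l * norm x"
    and l: "0 \<le> l"
    and X: "l * norm (X - Xs) \<le> k" and Y: "l * norm (Y - Ys) \<le> k"
  shows "norm ((L ** X) *v x) \<le> (1 + k) * norm x"
    and "norm ((M ** Y) *v x) \<le> (1 + k) * norm x"
    and "norm (mat 1 - transpose (M ** Y) ** (L ** X)) \<le> norm (mat 1 - Q) + 2 * k + k\<^sup>2"
proof -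
  define A where "A = L ** (X - Xs)"
  define B where "B = M ** (Y - Ys)"
  have A: "L ** X = Q + A" and B: "M ** Y = Q + B"
    unfolding A_def B_def by (simp_all add: matrix_mult_distribs LXs MYs)
  have nA: "norm A \<le> k" and nB: "norm B \<le> k"
    unfolding A_def B_def
    by (rule order_trans[OF norm_matrix_mult_le_left[OF L l] X])
      (rule order_trans[OF norm_matrix_mult_le_left[OF M l] Y])
  have aux: "norm ((Q + C) *v x) \<le> (1 + k) * norm x" if "norm C \<le> k" for C :: "real ^ 'r ^ 'r"
  proof -
    have "norm ((Q + C) *v x) \<le> norm (Q *v x) + norm (C *v x)"
      by (simp add: matrix_vector_mult_add_rdistrib norm_triangle_ineq)
    also have "\<dots> \<le> norm x + k * norm x"
      using Q(3)[of x] norm_matrix_vector_mult_le[of C x] mult_right_mono[OF that norm_ge_zero, of x]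
      by linarith
    finally show ?thesis by (simp add: algebra_simps)
  qed
  show "norm ((L ** X) *v x) \<le> (1 + k) * norm x" "norm ((M ** Y) *v x) \<le> (1 + k) * norm x"
    unfolding A B by (intro aux nA nB)+
  have "mat 1 - transpose (Q + B) ** (Q + A)
      = (mat 1 - Q) - Q ** A - transpose B ** Q - transpose B ** A"
    by (simp add: transpose_add matrix_mult_distribs Q)
  also have "norm \<dots> \<le> norm (mat 1 - Q) + norm (Q ** A) + norm (transpose B ** Q)
      + norm (transpose B ** A)"
    using norm_triangle_ineq4[of "mat 1 - Q - Q ** A - transpose B ** Q" "transpose B ** A"]
      norm_triangle_ineq4[of "mat 1 - Q - Q ** A" "transpose B ** Q"]
      norm_triangle_ineq4[of "mat 1 - Q" "Q ** A"] by linarith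
  also have "norm (Q ** A) \<le> k"
    using norm_matrix_mult_le_left[of Q 1 A] Q(3) nA by simp
  also have "norm (transpose B ** Q) \<le> k"
    using norm_matrix_mult_le_right[of Q 1 "transpose B"] Q(1,3) nB by simp
  also have "norm (transpose B ** A) \<le> k\<^sup>2"
  proof -
    have "norm (transpose B ** A) \<le> norm (transpose B) * norm A" by (rule norm_matrix_mult_le)
    also have "\<dots> \<le> k * k" using nA nB by (intro mult_mono) (auto intro: order_trans[OF norm_ge_zero])
    finally show ?thesis by (simp add: power2_eq_square)
  qed
  finally show "norm (mat 1 - transpose (M ** Y) ** (L ** X)) \<le> norm (mat 1 - Q) + 2 * k + k\<^sup>2"
    unfolding A B by simp
qed

text \<open>
  Evaluates the bound of \<open>damped_residual_bound\<close> for \<open>P = \<parallel>p\<parallel>\<close>, with \<open>t = \<omega>\<^sub>0 / \<omega>\<^sub>2\<close>, \<open>n = r - r\<^sup>\<star>\<close> and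
  \<open>l\<close> the reciprocal of the smallest nonzero singular value. The first summand dominates: it is at most
  \<open>t\<^sup>2 E\<^sup>2 / 2560\<close> by the condition on \<open>Cub\<close>, and the other two are of order \<open>l\<^sup>2 E\<^sup>3\<close>.
\<close>

lemma residual_smallness_arith:
  fixes E :: real
  assumes p: "P\<^sup>2 \<le> c * lam * E / 2 + lam * (a * l * E)\<^sup>2 / 2 + l\<^sup>2 * E ^ 3"
    and c: "c \<le> n + 1" and n: "0 \<le> n" and a: "a = 11 / 10" and E: "0 \<le> E" and P: "0 \<le> P"
    and lam: "0 \<le> lam" "lam \<le> Cub * E" and T: "0 \<le> t" "t \<le> 1"
    and Cub: "Cub \<le> t\<^sup>2 / (1280 * (n + 1)\<^sup>2)"
    and small: "l\<^sup>2 * E \<le> t\<^sup>2 / 2 ^ 19"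
  shows "P \<le> t / 32 * E"
proof -
  have n1: "1 \<le> (n + 1)" using n by simp
  have "t\<^sup>2 / (1280 * (n + 1)\<^sup>2) \<le> t\<^sup>2 / (1280 * (n + 1))"
    using mult_left_mono[OF n1, of "n + 1"] n
    by (intro divide_left_mono mult_left_mono) (auto simp: power2_eq_square)
  then have "Cub * (n + 1) \<le> t\<^sup>2 / (1280 * (n + 1)) * (n + 1)"
    using Cub n by (intro mult_right_mono) auto
  also have "\<dots> = t\<^sup>2 / 1280"
  proof -
    have cancel: "x / (1280 * N) * N = x / 1280" if "N \<noteq> 0" for x N :: real using that by simp
    show ?thesis by (rule cancel) (use n1 in simp)
  qed
  finally have C1: "(n + 1) * Cub \<le> t\<^sup>2 / 1280" by (simp only: mult.commute)
  have "t\<^sup>2 / (1280 * (n + 1)\<^sup>2) \<le> t\<^sup>2 / 1280"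
    using n1 n by (intro divide_left_mono) (auto simp: one_le_power)
  then have "Cub \<le> 1 / 1280" using Cub T power_le_one[of t 2] by linarith
  then have lam1: "lam \<le> E / 1280"
    using lam(2) E mult_right_mono[of Cub "1 / 1280" E] by simp
  have "c * lam \<le> (n + 1) * lam" using c lam(1) by (intro mult_right_mono) auto
  also have "\<dots> \<le> (n + 1) * (Cub * E)" using lam(2) n by (intro mult_left_mono) auto
  also have "\<dots> \<le> t\<^sup>2 / 1280 * E"
    using mult_right_mono[OF C1 E] by (simp add: mult_ac)
  finally have "c * lam * E / 2 \<le> t\<^sup>2 / 1280 * E * E / 2"
    using E by (intro divide_right_mono mult_right_mono) auto
  then have 1: "c * lam * E / 2 \<le> t\<^sup>2 * E\<^sup>2 / 2560" by (simp add: power2_eq_square)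
  have X: "l\<^sup>2 * E * E \<le> t\<^sup>2 / 2 ^ 19 * E" using small E by (rule mult_right_mono)
  then have X': "l\<^sup>2 * E\<^sup>2 \<le> t\<^sup>2 / 2 ^ 19 * E" by (simp add: power2_eq_square)
  have lam2: "lam * (l\<^sup>2 * E\<^sup>2) \<le> (E / 1280) * (t\<^sup>2 / 2 ^ 19 * E)"
    by (rule mult_mono) (use lam1 X' E in auto)
  have 2: "lam * (a * l * E)\<^sup>2 / 2 \<le> t\<^sup>2 * E\<^sup>2 / 2 ^ 19"
  proof -
    have "lam * (a * l * E)\<^sup>2 / 2 = 121 / 200 * (lam * (l\<^sup>2 * E\<^sup>2))"
      by (simp add: a power_mult_distrib power_divide)
    also have "\<dots> \<le> 121 / 200 * ((E / 1280) * (t\<^sup>2 / 2 ^ 19 * E))"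
      by (rule mult_left_mono[OF lam2]) simp
    also have "\<dots> = 121 / 256000 * (t\<^sup>2 * E\<^sup>2 / 2 ^ 19)"
      by (simp add: power2_eq_square)
    also have "\<dots> \<le> 1 * (t\<^sup>2 * E\<^sup>2 / 2 ^ 19)"
      by (rule mult_right_mono) simp_all
    finally show ?thesis by simp
  qed
  have 3: "l\<^sup>2 * E ^ 3 \<le> t\<^sup>2 * E\<^sup>2 / 2 ^ 19"
    using mult_right_mono[OF X E] by (simp add: power2_eq_square power3_eq_cube)
  define z where "z = t\<^sup>2 * E\<^sup>2"
  have z: "0 \<le> z" by (simp add: z_def)
  have "P\<^sup>2 \<le> z / 2560 + z / 2 ^ 19 + z / 2 ^ 19"
    using p 1 2 3 unfolding z_def[symmetric] by linarith
  also have "\<dots> \<le> z / 1024" using z by simp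
  finally have "P\<^sup>2 \<le> t\<^sup>2 * E\<^sup>2 / 1024" by (simp only: z_def)
  also have "\<dots> = (t / 32 * E)\<^sup>2" by (simp add: power_mult_distrib power_divide)
  finally show ?thesis by (rule power2_le_imp_le) (use T E in simp)
qed

section \<open>Damped least squares and orthogonal projection\<close>

text \<open>
  \<open>D\<^sup>T D + \<lambda>\<close> is positive definite, hence injective, hence onto; so \<open>inv\<close> is an actual inverse here.
\<close>

lemma damped_solution:
  fixes D :: "'x::euclidean_space \<Rightarrow> 'z::euclidean_space"
  assumes D: "linear D" and lam: "0 < lam"
    and s_def: "s = inv (\<lambda>u. adjoint D (D u) + lam *\<^sub>R u) w"
  shows "adjoint D (D s) + lam *\<^sub>R s = w"
proof -
  let ?T = "\<lambda>u. adjoint D (D u) + lam *\<^sub>R u"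
  have lin: "linear ?T"
    using linear_compose[OF D adjoint_linear[OF D]]
    by (intro linear_compose_add linear_compose_scale_right) (auto simp: comp_def linear_id[unfolded id_def])
  have "inj ?T"
  proof (rule linear_injective_0[OF lin, THEN iffD2], intro allI impI)
    fix u assume "?T u = 0"
    then have "0 = u \<bullet> ?T u" by simp
    also have "\<dots> = (norm (D u))\<^sup>2 + lam * (norm u)\<^sup>2"
      by (simp add: inner_add_right adjoint_works[OF D] power2_norm_eq_inner)
    finally have "lam * (norm u)\<^sup>2 = 0"
      using lam by (metis add_nonneg_eq_0_iff less_imp_le mult_nonneg_nonneg zero_le_power2)
    then show "u = 0" using lam by simp
  qed
  then have "surj ?T" using lin by (simp add: linear_injective_imp_surjective)
  then show ?thesis unfolding s_def by (rule surj_f_inv_f)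
qed

text \<open>
  Both bounds come from pairing the equation with \<open>s\<close>, that is \<open>\<parallel>D s\<parallel>\<^sup>2 + \<lambda> \<parallel>s\<parallel>\<^sup>2 = \<langle>D s, w\<rangle>\<close>. The second
  one is the fact that \<open>\<sigma> / (\<sigma>\<^sup>2 + \<lambda>) \<le> 1 / (2 \<surd>\<lambda>)\<close> for every singular value \<open>\<sigma>\<close> of \<open>D\<close>.
\<close>

lemma damped_solution_bounds:
  fixes D :: "'x::euclidean_space \<Rightarrow> 'z::euclidean_space"
  assumes D: "linear D" and lam: "0 < lam"
    and s: "adjoint D (D s) + lam *\<^sub>R s = adjoint D w"
  shows "norm (D s) \<le> norm w" "lam * (norm s)\<^sup>2 \<le> (norm w)\<^sup>2 / 4"
proof -
  have "(norm (D s))\<^sup>2 + lam * (norm s)\<^sup>2 = s \<bullet> (adjoint D (D s) + lam *\<^sub>R s)"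
    by (simp add: inner_add_right adjoint_works[OF D] power2_norm_eq_inner)
  also have "\<dots> = D s \<bullet> w" by (simp add: s adjoint_works[OF D])
  also have "\<dots> \<le> norm (D s) * norm w" by (rule norm_cauchy_schwarz)
  finally have *: "(norm (D s))\<^sup>2 + lam * (norm s)\<^sup>2 \<le> norm (D s) * norm w" .
  moreover have "0 \<le> lam * (norm s)\<^sup>2" using lam by simp
  ultimately have "norm (D s) * norm (D s) \<le> norm w * norm (D s)"
    by (simp add: power2_eq_square mult.commute)
  then show "norm (D s) \<le> norm w"
    by (cases "norm (D s) = 0") (auto simp: mult_le_cancel_right)
  have "0 \<le> (norm (D s) - norm w / 2)\<^sup>2" by simp
  then show "lam * (norm s)\<^sup>2 \<le> (norm w)\<^sup>2 / 4"
    using * by (simp add: power2_eq_square field_simps)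
qed

lemma orth_proj_properties:
  fixes S :: "'z::euclidean_space set"
  assumes "subspace S"
  shows "orth_proj S v \<in> S" "w \<in> S \<Longrightarrow> (v - orth_proj S v) \<bullet> w = 0"
proof -
  obtain y z where yz: "y \<in> span S" "\<And>w. w \<in> span S \<Longrightarrow> orthogonal z w" "v = y + z"
    using orthogonal_subspace_decomp_exists[of S v] by blast
  have span: "span S = S" using assms by (simp add: span_eq_iff)
  let ?Q = "\<lambda>p. p \<in> S \<and> (\<forall>w\<in>S. orthogonal (v - p) w)"
  have Q: "?Q y" using yz by (simp add: span)
  have "p = y" if "?Q p" for p
  proof -
    have d: "p - y \<in> S" using that Q assms by (simp add: subspace_diff)
    have "(p - y) \<bullet> (p - y) = (v - y) \<bullet> (p - y) - (v - p) \<bullet> (p - y)"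
      by (simp add: inner_diff_left)
    also have "\<dots> = 0" using that Q d unfolding orthogonal_def by simp
    finally show "p = y" by simp
  qed
  then have "?Q (orth_proj S v)" unfolding orth_proj_def using Q by (rule theI[rotated])
  then show "orth_proj S v \<in> S" "w \<in> S \<Longrightarrow> (v - orth_proj S v) \<bullet> w = 0"
    by (auto simp: orthogonal_def)
qed

text \<open>
  The Polyak computation for an abstract linear map \<open>D\<close>, given that \<open>v\<close> hardly sees the residual \<open>e - D t\<close>. As
  the damped projection is symmetric, \<open>\<langle>D s, e\<rangle> = \<langle>v, D t\<rangle> \<ge> 15/16 \<Delta>\<close>. With \<open>\<tau> = \<Delta> / \<pi>\<close> the step without the
  perturbation \<open>q\<close> lowers the squared error by at least \<open>7/8 \<gamma> \<tau>\<^sup>2\<close>. The perturbation (the quadratic term of the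
  factorization) has norm at most \<open>\<gamma>\<^sup>2 \<tau>\<^sup>2 / (8 \<lambda>)\<close>, and since \<open>\<gamma> E \<le> Clb E \<le> \<lambda>\<close> it costs only a
  fraction of that gain. Finally \<open>\<tau> \<ge> \<omega>\<^sub>0 E / \<omega>\<^sub>2\<close> by sharpness. Conversely \<open>15/16 \<Delta> \<le> \<langle>v, D t\<rangle> \<le> \<pi> E\<close>
  bounds \<open>\<tau>\<close> by \<open>16/15 E\<close>, which limits the length of the step.
\<close>

lemma damped_polyak_step:
  fixes D :: "'x::euclidean_space \<Rightarrow> 'z::euclidean_space"
  assumes D: "linear D" and lam: "0 < lam"
    and s: "adjoint D (D s) + lam *\<^sub>R s = adjoint D v"
    and t: "adjoint D (D t) + lam *\<^sub>R t = adjoint D e"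
    and gap: "0 < \<Delta>" "\<Delta> \<le> v \<bullet> e" "\<omega>0 * norm e \<le> \<Delta>"
    and align: "v \<bullet> (e - D t) \<le> \<Delta> / 16"
    and \<pi>_def: "\<pi> = norm (orth_proj (range D) v)" and \<pi>: "\<pi> \<le> \<omega>2"
    and \<omega>0: "0 < \<omega>0"
    and \<gamma>: "0 < \<gamma>" "\<gamma> \<le> 1" "\<gamma> \<le> Clb / sqrt 2" and Clb: "0 < Clb" "Clb * norm e \<le> lam"
    and e: "e \<noteq> 0"
    and g: "g = \<gamma> * \<Delta> / \<pi>\<^sup>2"
    and q: "norm q \<le> g\<^sup>2 * (norm s)\<^sup>2 / 2"
  shows "(norm (e - g *\<^sub>R D s + q))\<^sup>2 \<le> (1 - \<gamma> / 8 * (\<omega>0\<^sup>2 / \<omega>2\<^sup>2)) * (norm e)\<^sup>2"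
    and "g * norm s \<le> \<gamma> * sqrt (norm e / Clb)"
proof -
  define E where "E = norm e"
  have E: "0 < E" using e by (simp add: E_def)
  let ?P = "orth_proj (range D) v"
  have sub: "subspace (range D)" using D by (simp add: linear_subspace_image)
  have Pw: "D u \<bullet> v = D u \<bullet> ?P" for u
    using orth_proj_properties(2)[OF sub, of "D u" v] by (simp add: inner_diff_left inner_diff_right inner_commute)
  have "adjoint D v = adjoint D ?P"
    by (rule vector_eq_ldot[THEN iffD1]) (simp add: adjoint_works[OF D] Pw)
  then have "adjoint D (D s) + lam *\<^sub>R s = adjoint D ?P" using s by simp
  from damped_solution_bounds[OF D lam this]
  have Ds: "norm (D s) \<le> \<pi>" and s2: "lam * (norm s)\<^sup>2 \<le> \<pi>\<^sup>2 / 4"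
    by (simp_all add: \<pi>_def)
  have Dt: "norm (D t) \<le> E"
    using damped_solution_bounds(1)[OF D lam t] by (simp add: E_def)
  have "D s \<bullet> e = s \<bullet> (adjoint D (D t) + lam *\<^sub>R t)"
    by (simp add: t adjoint_works[OF D])
  also have "\<dots> = (adjoint D (D s) + lam *\<^sub>R s) \<bullet> t"
    by (simp add: inner_add_left inner_add_right adjoint_works[OF D] adjoint_clauses[OF D])
  also have "\<dots> = D t \<bullet> v" by (simp add: s adjoint_clauses[OF D] inner_commute)
  finally have sym: "D s \<bullet> e = D t \<bullet> v" .
  have "v \<bullet> D t = v \<bullet> e - v \<bullet> (e - D t)" by (simp add: inner_diff_right)
  then have low: "15 / 16 * \<Delta> \<le> D t \<bullet> v" using gap align by (simp add: inner_commute)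
  have "D t \<bullet> v \<le> norm (D t) * norm ?P" unfolding Pw by (rule norm_cauchy_schwarz)
  also have "\<dots> \<le> E * \<pi>" using Dt by (simp add: \<pi>_def mult_right_mono)
  finally have E\<pi>: "15 / 16 * \<Delta> \<le> E * \<pi>" using low by simp
  then have \<pi>0: "0 < \<pi>"
    using gap(1) E by (metis \<pi>_def norm_ge_zero less_eq_real_def mult_zero_right mult_pos_pos not_le
        zero_less_divide_iff zero_less_numeral)
  define \<tau> where "\<tau> = \<Delta> / \<pi>"
  have \<tau>0: "0 < \<tau>" using gap(1) \<pi>0 by (simp add: \<tau>_def)
  have \<Delta>: "\<Delta> = \<tau> * \<pi>" using \<pi>0 by (simp add: \<tau>_def)
  have g\<pi>: "g * \<pi> = \<gamma> * \<tau>" using \<pi>0 by (simp add: g \<Delta> power2_eq_square)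
  have g0: "0 < g" using g\<pi> \<gamma>(1) \<tau>0 \<pi>0 by (metis mult_pos_pos zero_less_mult_pos2)
  have \<tau>E: "\<tau> \<le> 16 / 15 * E" using E\<pi> \<pi>0 unfolding \<Delta> by simp
  have \<tau>low: "\<omega>0 / \<omega>2 * E \<le> \<tau>"
  proof -
    have "\<omega>0 * E \<le> \<tau> * \<omega>2"
      using gap(3) \<pi> \<tau>0 unfolding \<Delta> E_def by (meson less_imp_le mult_left_mono order_trans)
    then show ?thesis using \<pi> \<pi>0 by (simp add: field_simps)
  qed
  have gsq: "g\<^sup>2 * \<pi>\<^sup>2 = \<gamma>\<^sup>2 * \<tau>\<^sup>2" using g\<pi> by (metis power_mult_distrib)
  have lamE: "\<gamma> * E \<le> lam"
  proof -
    have "Clb / sqrt 2 \<le> Clb" using Clb(1) by (simp add: divide_le_eq)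
    then have "\<gamma> * E \<le> Clb * E" using \<gamma>(3) E by (intro mult_right_mono) auto
    then show ?thesis using Clb(2) by (simp add: E_def)
  qed
  have s2': "(norm s)\<^sup>2 \<le> \<pi>\<^sup>2 / (4 * lam)"
    using s2 lam by (simp add: field_simps)
  then have gs2: "g\<^sup>2 * (norm s)\<^sup>2 \<le> \<gamma>\<^sup>2 * \<tau>\<^sup>2 / (4 * lam)"
    using mult_left_mono[OF s2', of "g\<^sup>2"] by (simp add: gsq[symmetric])
  have qle: "norm q \<le> \<gamma> * \<tau>\<^sup>2 / (8 * E)"
  proof -
    have "norm q \<le> \<gamma>\<^sup>2 * \<tau>\<^sup>2 / (8 * lam)" using q gs2 by simp
    also have "\<dots> \<le> \<gamma>\<^sup>2 * \<tau>\<^sup>2 / (8 * (\<gamma> * E))"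
      using lamE \<gamma>(1) E lam by (intro divide_left_mono) auto
    also have "\<dots> = \<gamma> * \<tau>\<^sup>2 / (8 * E)" using \<gamma>(1) by (simp add: power2_eq_square)
    finally show ?thesis .
  qed
  define a where "a = norm (e - g *\<^sub>R D s)"
  have "a\<^sup>2 = E\<^sup>2 - 2 * g * (D s \<bullet> e) + g\<^sup>2 * (norm (D s))\<^sup>2"
    unfolding a_def E_def power2_norm_eq_inner
    by (simp add: inner_diff_left inner_diff_right inner_commute power2_eq_square algebra_simps)
  also have "\<dots> \<le> E\<^sup>2 - 2 * g * (15 / 16 * \<Delta>) + g\<^sup>2 * \<pi>\<^sup>2"
  proof -
    have "g * (15 / 16 * \<Delta>) \<le> g * (D s \<bullet> e)"
      using low g0 unfolding sym by (intro mult_left_mono) auto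
    moreover have "g\<^sup>2 * (norm (D s))\<^sup>2 \<le> g\<^sup>2 * \<pi>\<^sup>2"
      using Ds by (intro mult_left_mono power_mono) auto
    ultimately show ?thesis by linarith
  qed
  also have "\<dots> = E\<^sup>2 - 15 / 8 * (\<gamma> * \<tau>\<^sup>2) + \<gamma>\<^sup>2 * \<tau>\<^sup>2"
  proof -
    have "g * \<Delta> = (g * \<pi>) * \<tau>" by (simp add: \<Delta>)
    then have "g * \<Delta> = \<gamma> * \<tau>\<^sup>2" by (simp add: g\<pi> power2_eq_square)
    then show ?thesis unfolding gsq by simp
  qed
  also have "\<gamma>\<^sup>2 * \<tau>\<^sup>2 \<le> \<gamma> * \<tau>\<^sup>2"
    using \<gamma> by (intro mult_right_mono) (auto simp: power2_eq_square mult_left_le)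
  finally have a2: "a\<^sup>2 \<le> E\<^sup>2 - 7 / 8 * (\<gamma> * \<tau>\<^sup>2)" by simp
  have \<gamma>\<tau>: "0 \<le> \<gamma> * \<tau>\<^sup>2" using \<gamma>(1) by simp
  have aE: "a \<le> E"
    by (rule power2_le_imp_le) (use a2 \<gamma>\<tau> E in auto)
  have "(norm (e - g *\<^sub>R D s + q))\<^sup>2 \<le> (a + norm q)\<^sup>2"
    unfolding a_def by (intro power_mono norm_triangle_ineq) auto
  also have "\<dots> = a\<^sup>2 + 2 * (a * norm q) + norm q * norm q"
    by (simp add: power2_eq_square algebra_simps)
  also have "a * norm q \<le> E * (\<gamma> * \<tau>\<^sup>2 / (8 * E))"
    using aE qle E by (intro mult_mono) auto
  also have "E * (\<gamma> * \<tau>\<^sup>2 / (8 * E)) = \<gamma> * \<tau>\<^sup>2 / 8" using E by simp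
  also have "norm q * norm q \<le> \<gamma> * \<tau>\<^sup>2 / 8"
  proof -
    have t2: "\<tau>\<^sup>2 \<le> 2 * E\<^sup>2"
    proof -
      have "\<tau>\<^sup>2 \<le> (16 / 15 * E)\<^sup>2" using \<tau>E \<tau>0 by (intro power_mono) auto
      also have "\<dots> = 256 / 225 * E\<^sup>2" by (simp add: power_mult_distrib power_divide)
      also have "\<dots> \<le> 2 * E\<^sup>2" by (intro mult_right_mono) auto
      finally show ?thesis .
    qed
    have "norm q * norm q \<le> (\<gamma> * \<tau>\<^sup>2 / (8 * E)) * (\<gamma> * \<tau>\<^sup>2 / (8 * E))"
      using qle by (intro mult_mono) (auto intro: order_trans[OF norm_ge_zero])
    also have "\<dots> = (\<gamma> * \<tau>\<^sup>2) * (\<gamma> * (\<tau>\<^sup>2 / E\<^sup>2) / 64)"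
      by (simp add: power2_eq_square field_simps)
    also have "\<dots> \<le> (\<gamma> * \<tau>\<^sup>2) * (1 / 8)"
    proof (rule mult_left_mono[OF _ \<gamma>\<tau>])
      have "\<tau>\<^sup>2 / E\<^sup>2 \<le> 2" using t2 E by (simp add: divide_le_eq)
      then have "\<gamma> * (\<tau>\<^sup>2 / E\<^sup>2) \<le> 1 * 2" using \<gamma> by (intro mult_mono) auto
      then show "\<gamma> * (\<tau>\<^sup>2 / E\<^sup>2) / 64 \<le> 1 / 8" by simp
    qed
    finally show ?thesis by simp
  qed
  finally have main: "(norm (e - g *\<^sub>R D s + q))\<^sup>2 \<le> E\<^sup>2 - 1 / 8 * (\<gamma> * \<tau>\<^sup>2)"
    using a2 \<gamma>\<tau> by linarith
  have "\<omega>0\<^sup>2 / \<omega>2\<^sup>2 * E\<^sup>2 \<le> \<tau>\<^sup>2"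
    using power_mono[OF \<tau>low, of 2] \<omega>0 \<pi> \<pi>0 E by (simp add: power_mult_distrib power_divide)
  then have "\<gamma> * (\<omega>0\<^sup>2 / \<omega>2\<^sup>2 * E\<^sup>2) \<le> \<gamma> * \<tau>\<^sup>2"
    using \<gamma>(1) by (intro mult_left_mono) auto
  with main show "(norm (e - g *\<^sub>R D s + q))\<^sup>2 \<le> (1 - \<gamma> / 8 * (\<omega>0\<^sup>2 / \<omega>2\<^sup>2)) * (norm e)\<^sup>2"
    unfolding E_def[symmetric] by (simp add: algebra_simps)
  show "g * norm s \<le> \<gamma> * sqrt (norm e / Clb)"
  proof (rule power2_le_imp_le)
    have "(g * norm s)\<^sup>2 \<le> \<gamma>\<^sup>2 * \<tau>\<^sup>2 / (4 * lam)" using gs2 by (simp add: power_mult_distrib)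
    also have "\<dots> \<le> \<gamma>\<^sup>2 * (4 * E\<^sup>2) / (4 * (Clb * E))"
    proof (rule frac_le)
      have "\<tau>\<^sup>2 \<le> (2 * E)\<^sup>2" using \<tau>E \<tau>0 E by (intro power_mono) auto
      then show "\<gamma>\<^sup>2 * \<tau>\<^sup>2 \<le> \<gamma>\<^sup>2 * (4 * E\<^sup>2)" by (intro mult_left_mono) (auto simp: power_mult_distrib)
    qed (use Clb E in \<open>auto simp: E_def\<close>)
    also have "\<dots> = \<gamma>\<^sup>2 * (norm e / Clb)"
      using E by (simp add: E_def power2_eq_square)
    also have "\<dots> = (\<gamma> * sqrt (norm e / Clb))\<^sup>2"
      using Clb(1) by (simp add: power_mult_distrib)
    finally show "(g * norm s)\<^sup>2 \<le> (\<gamma> * sqrt (norm e / Clb))\<^sup>2" .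
  qed (use \<gamma>(1) Clb(1) in simp)
qed

section \<open>The factorization map\<close>

definition prod_deriv ::
    "real ^ 'r ^ 'd1 \<Rightarrow> real ^ 'r ^ 'd2 \<Rightarrow> (real ^ 'r ^ 'd1) \<times> (real ^ 'r ^ 'd2) \<Rightarrow> real ^ 'd2 ^ 'd1"
  where "prod_deriv X Y u = fst u ** transpose Y + X ** transpose (snd u)"

lemma linear_prod_deriv: "linear (prod_deriv X Y)"
  by (rule linearI)
    (simp_all add: prod_deriv_def matrix_mult_distribs transpose_add transpose_scaleR scaleR_add_right
      bounded_bilinear.scaleR_left[OF bounded_bilinear_matrix_mult]
      bounded_bilinear.scaleR_right[OF bounded_bilinear_matrix_mult])

lemma frechet_derivative_prod:
  "frechet_derivative (\<lambda>(X :: real ^ 'r ^ 'd1, Y :: real ^ 'r ^ 'd2). X ** transpose Y) (at (X, Y))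
    = prod_deriv X Y"
proof -
  have "bounded_linear (transpose :: real ^ 'r ^ 'd2 \<Rightarrow> real ^ 'd2 ^ 'r)"
    by (intro linear_conv_bounded_linear[THEN iffD1] linearI) (simp_all add: transpose_add transpose_scaleR)
  then have "((\<lambda>x :: (real ^ 'r ^ 'd1) \<times> (real ^ 'r ^ 'd2). transpose (snd x)) has_derivative
      (\<lambda>u. transpose (snd u))) (at (X, Y))"
    by (rule bounded_linear.has_derivative) (rule has_derivative_snd, rule has_derivative_ident)
  moreover have "((\<lambda>x :: (real ^ 'r ^ 'd1) \<times> (real ^ 'r ^ 'd2). fst x) has_derivative fst) (at (X, Y))"
    by (rule has_derivative_fst) (rule has_derivative_ident)
  ultimately have "((\<lambda>x :: (real ^ 'r ^ 'd1) \<times> (real ^ 'r ^ 'd2). fst x ** transpose (snd x)) has_derivative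
      (\<lambda>u. fst (X, Y) ** transpose (snd u) + fst u ** transpose (snd (X, Y)))) (at (X, Y))"
    using bounded_bilinear.FDERIV[OF bounded_bilinear_matrix_mult] by blast
  then have "((\<lambda>(X :: real ^ 'r ^ 'd1, Y :: real ^ 'r ^ 'd2). X ** transpose Y) has_derivative
      prod_deriv X Y) (at (X, Y))"
    by (simp add: case_prod_unfold prod_deriv_def[abs_def] add.commute)
  then show ?thesis by (metis frechet_derivative_at)
qed

lemma adjoint_prod_deriv: "adjoint (prod_deriv X Y) p = (p ** Y, transpose p ** X)"
proof -
  have "x \<bullet> (p ** Y, transpose p ** X) = prod_deriv X Y x \<bullet> p" for x p
  proof -
    have "(X ** transpose (snd x)) \<bullet> p = transpose (snd x) \<bullet> (transpose X ** p)"
      by (rule inner_matrix_mult_left)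
    also have "\<dots> = snd x \<bullet> (transpose p ** X)"
      using inner_transpose[of "snd x" "transpose p ** X"] by (simp add: matrix_transpose_mul)
    finally show ?thesis
      by (simp add: prod_deriv_def inner_add_left inner_prod_def inner_matrix_mult_right)
  qed
  then have "adjoint (prod_deriv X Y) = (\<lambda>p. (p ** Y, transpose p ** X))"
    by (intro adjoint_unique) (simp add: inner_commute)
  then show ?thesis by simp
qed

lemma prod_step:
  fixes X :: "real ^ 'r ^ 'd1" and Y :: "real ^ 'r ^ 'd2"
  assumes "(X', Y') = (X, Y) - g *\<^sub>R s"
  shows "X' ** transpose Y' = X ** transpose Y - g *\<^sub>R prod_deriv X Y s
      + g\<^sup>2 *\<^sub>R (fst s ** transpose (snd s))"
proof -
  have "X' = X - g *\<^sub>R fst s" "Y' = Y - g *\<^sub>R snd s"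
    using assms by (auto simp: prod_eq_iff)
  then show ?thesis
    by (simp add: prod_deriv_def matrix_mult_distribs transpose_diff transpose_scaleR scaleR_add_right
        bounded_bilinear.scaleR_left[OF bounded_bilinear_matrix_mult]
        bounded_bilinear.scaleR_right[OF bounded_bilinear_matrix_mult] power2_eq_square
        scaleR_diff_right)
qed

lemma norm_prod_second_order:
  fixes s :: "(real ^ 'r ^ 'd1) \<times> (real ^ 'r ^ 'd2)"
  shows "norm (fst s ** transpose (snd s)) \<le> (norm s)\<^sup>2 / 2"
proof -
  have "norm (fst s ** transpose (snd s)) \<le> norm (fst s) * norm (snd s)"
    using norm_matrix_mult_le[of "fst s" "transpose (snd s)"] by simp
  moreover have "(norm s)\<^sup>2 = (norm (fst s))\<^sup>2 + (norm (snd s))\<^sup>2"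
    by (cases s) (simp add: norm_Pair)
  moreover have "0 \<le> (norm (fst s) - norm (snd s))\<^sup>2" by simp
  ultimately show ?thesis by (simp add: power2_diff)
qed

section \<open>The robust loss\<close>

lemma l1_on_triangle: "l1_on J (x + y) \<le> l1_on J x + l1_on J y"
  unfolding l1_on_def by (simp add: sum.distrib[symmetric]) (intro sum_mono abs_triangle_ineq)

lemma l1_on_split: "l1_on UNIV (y :: real ^ 'm) = l1_on (- I) y + l1_on I y"
  unfolding l1_on_def Compl_eq_Diff_UNIV by (rule sum.subset_diff) simp_all

lemma subgradient_l1_bound:
  fixes A :: "'z::euclidean_space \<Rightarrow> real ^ 'm"
  assumes A: "linear A" and v: "v \<in> subdifferential (\<lambda>Z. l1_on UNIV (A Z - b)) z"
  shows "v \<bullet> w \<le> l1_on UNIV (A w)"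
proof -
  have "l1_on UNIV (A (z + w) - b) \<ge> l1_on UNIV (A z - b) + v \<bullet> (z + w - z)"
    using v by (simp only: subdifferential_def mem_Collect_eq)
  moreover have "A (z + w) - b = A w + (A z - b)" by (simp add: linear_add[OF A])
  ultimately show ?thesis using l1_on_triangle[of UNIV "A w" "A z - b"] by simp
qed

text \<open>
  Off \<open>I\<close> the measurements are exact, so these residuals vanish at \<open>Zs\<close>; on \<open>I\<close> the arbitrary values \<open>b\<close> cost at most
  the triangle inequality.
\<close>

lemma sharpness:
  fixes A :: "'z::euclidean_space \<Rightarrow> real ^ 'm"
  assumes A: "linear A" and b: "\<And>i. i \<notin> I \<Longrightarrow> b $ i = A Zs $ i"
  shows "l1_on UNIV (A Z - b) - l1_on UNIV (A Zs - b)
    \<ge> l1_on (- I) (A (Z - Zs)) - l1_on I (A (Z - Zs))"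
proof -
  have "l1_on (- I) (A Zs - b) = 0" "l1_on (- I) (A Z - b) = l1_on (- I) (A (Z - Zs))"
    using b by (simp_all add: l1_on_def linear_diff[OF A])
  moreover have "l1_on I (A Zs - b) \<le> l1_on I (A (Z - Zs)) + l1_on I (A Z - b)"
    unfolding l1_on_def sum.distrib[symmetric]
  proof (rule sum_mono)
    fix i
    have "\<bar>A Zs $ i - b $ i\<bar> \<le> \<bar>A Z $ i - A Zs $ i\<bar> + \<bar>A Z $ i - b $ i\<bar>" by linarith
    then show "\<bar>(A Zs - b) $ i\<bar> \<le> \<bar>A (Z - Zs) $ i\<bar> + \<bar>(A Z - b) $ i\<bar>"
      by (simp add: linear_diff[OF A])
  qed
  ultimately show ?thesis
    using l1_on_split[of "A Z - b" I] l1_on_split[of "A Zs - b" I] by linarith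
qed

text \<open>
  The upper bound on \<open>A\<close> is available for rank at most \<open>2r\<close>, whereas \<open>p\<close> is a sum of three matrices of rank up to
  \<open>r\<close>. Splitting \<open>p\<close> by the orthogonal projection \<open>P\<close> onto the columns of \<open>Y\<close> resolves this: \<open>p P\<close> has rank at
  most \<open>r\<close>, and the factor \<open>1 - P\<close> annihilates the terms ending in \<open>Y\<^sup>T\<close>, leaving two summands.
\<close>

lemma residual_test_bound:
  fixes v :: "real ^ 'd2 ^ 'd1" and X Xs U :: "real ^ 'r ^ 'd1" and Y Ys W :: "real ^ 'r ^ 'd2"
  assumes v: "\<And>w. rank w \<le> 2 * CARD('r) \<Longrightarrow> v \<bullet> w \<le> \<omega> * norm w" and \<omega>: "0 \<le> \<omega>"
    and p: "p = (X ** transpose Y - Xs ** transpose Ys) - prod_deriv X Y (U, W)"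
  shows "v \<bullet> p \<le> 2 * \<omega> * norm p"
proof -
  obtain P :: "real ^ 'd2 ^ 'd2" where P: "transpose P = P" "P ** P = P" "range ((*v) P) = range ((*v) Y)"
    by (rule orthogonal_projection_matrix_exists[of "range ((*v) Y)"]) (auto intro!: linear_subspace_image)
  let ?R = "mat 1 - P"
  have R: "transpose ?R = ?R" "?R ** ?R = ?R"
    by (simp_all add: transpose_diff matrix_mult_distribs P)
  have PY: "P ** Y = Y"
  proof -
    have "P *v (Y *v x) = Y *v x" for x
    proof -
      have "Y *v x \<in> range ((*v) P)" unfolding P(3) by simp
      then obtain y where "Y *v x = P *v y" by blast
      then show ?thesis by (simp add: matrix_vector_mul_assoc P(2))
    qed
    then show ?thesis by (simp add: matrix_eq matrix_vector_mul_assoc[symmetric])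
  qed
  then have "transpose (P ** Y) = transpose Y" by simp
  then have "transpose Y ** P = transpose Y" unfolding matrix_transpose_mul P(1) .
  then have YR: "transpose Y ** ?R = 0" by (simp add: matrix_mult_distribs)
  have "rank (p ** P) \<le> 2 * CARD('r)"
  proof -
    have "rank (p ** P) \<le> rank P" by (rule rank_mul_le_right)
    also have "\<dots> = rank Y" by (simp add: rank_dim_range P(3))
    also have "\<dots> \<le> CARD('r)" using rank_bound[of Y] by simp
    finally show ?thesis by simp
  qed
  moreover have "rank (p ** ?R) \<le> 2 * CARD('r)"
  proof -
    have "p = (X - U) ** transpose Y - X ** transpose W - Xs ** transpose Ys"
      by (simp add: p prod_deriv_def matrix_mult_distribs)
    then have "p ** ?R = (X - U) ** (transpose Y ** ?R) - X ** (transpose W ** ?R) - Xs ** (transpose Ys ** ?R)"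
      by (simp add: bounded_bilinear.diff_left[OF bounded_bilinear_matrix_mult] matrix_mul_assoc
          del: matrix_mul_rid)
    then have "p ** ?R = X ** (- (transpose W ** ?R)) - Xs ** (transpose Ys ** ?R)"
      by (simp only: YR) (simp add: bounded_bilinear.minus_right[OF bounded_bilinear_matrix_mult]
          bounded_bilinear.zero_right[OF bounded_bilinear_matrix_mult])
    then have "rank (p ** ?R) \<le> rank (X ** (- (transpose W ** ?R))) + rank (Xs ** (transpose Ys ** ?R))"
      by (simp only: rank_diff_le)
    also have "\<dots> \<le> CARD('r) + CARD('r)" by (intro add_mono rank_matrix_mult_le)
    finally show ?thesis by simp
  qed
  ultimately have "v \<bullet> (p ** P) + v \<bullet> (p ** ?R) \<le> \<omega> * norm (p ** P) + \<omega> * norm (p ** ?R)"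
    by (intro add_mono v)
  also have "v \<bullet> (p ** P) + v \<bullet> (p ** ?R) = v \<bullet> p"
    unfolding inner_add_right[symmetric] by (simp add: matrix_mult_distribs)
  also have "\<omega> * norm (p ** P) \<le> \<omega> * norm p"
    using norm_matrix_mult_le_right[of P 1 p] norm_projection_vector_le[OF P(1,2)] \<omega> P(1)
    by (intro mult_left_mono) simp_all
  also have "\<omega> * norm (p ** ?R) \<le> \<omega> * norm p"
    using norm_matrix_mult_le_right[of ?R 1 p] norm_projection_vector_le[OF R] \<omega> R(1)
    by (intro mult_left_mono) simp_all
  finally show ?thesis by simp
qed

section \<open>Convergence of the LMM subgradient method\<close>

text \<open>
  The residual estimates supply the alignment hypothesis of \<open>damped_polyak_step\<close>:
  \<open>\<langle>v, p\<rangle> \<le> 2 \<omega>\<^sub>2 \<parallel>p\<parallel> \<le> \<omega>\<^sub>0 E / 16 \<le> \<Delta> / 16\<close>.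
\<close>

lemma lmm_polyak_step_contracts:
  fixes A :: "real ^ 'd2 ^ 'd1 \<Rightarrow> real ^ 'm" and X Xs X' :: "real ^ 'r ^ 'd1" and Y Ys Y' :: "real ^ 'r ^ 'd2"
    and L :: "real ^ 'd1 ^ 'r" and M :: "real ^ 'd2 ^ 'r" and Q :: "real ^ 'r ^ 'r"
    and b :: "real ^ 'm" and h :: "real ^ 'd2 ^ 'd1 \<Rightarrow> real"
  assumes A: "linear A" and h_def: "h = (\<lambda>Z. l1_on UNIV (A Z - b))"
    and upper: "\<And>Z. rank Z \<le> 2 * CARD('r) \<Longrightarrow> l1_on UNIV (A Z) \<le> \<omega>2 * norm Z"
    and sharp: "\<omega>0 * norm (X ** transpose Y - Zs) \<le> h (X ** transpose Y) - h Zs"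
    and \<omega>: "0 < \<omega>0" "\<omega>0 \<le> \<omega>2"
    and Zs: "Zs = Xs ** transpose Ys"
    and LXs: "L ** Xs = Q" and MYs: "M ** Ys = Q" and XsQ: "Xs ** Q = Xs"
    and Q: "transpose Q = Q" "Q ** Q = Q" "norm (mat 1 - Q) \<le> n"
    and L: "\<And>x. norm (L *v x) \<le> 1 / \<mu> * norm x" and M: "\<And>x. norm (M *v x) \<le> 1 / \<mu> * norm x"
    and \<mu>: "0 < \<mu>"
    and near: "norm (X - Xs) \<le> \<mu> / 10" "norm (Y - Ys) \<le> \<mu> / 10"
    and small: "norm (X ** transpose Y - Zs) \<le> (\<omega>0 / \<omega>2)\<^sup>2 * \<mu>\<^sup>2 / 2 ^ 19"
    and ne: "X ** transpose Y \<noteq> Zs"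
    and \<gamma>: "0 < \<gamma>" "\<gamma> \<le> 1" "\<gamma> \<le> Clb / sqrt 2" and Clb: "0 < Clb"
    and Cub: "Cub \<le> (\<omega>0 / \<omega>2)\<^sup>2 / (1280 * (n + 1)\<^sup>2)"
    and lam: "0 < lam" "Clb * norm (X ** transpose Y - Zs) \<le> lam"
      "lam \<le> Cub * norm (X ** transpose Y - Zs)"
    and v: "v \<in> subdifferential h (X ** transpose Y)"
    and g: "g = \<gamma> * (h (X ** transpose Y) - h Zs)
        / (norm (orth_proj (range (prod_deriv X Y)) v))\<^sup>2"
    and step: "(X', Y') = (X, Y) - g *\<^sub>R inv (\<lambda>u. adjoint (prod_deriv X Y) (prod_deriv X Y u)
        + lam *\<^sub>R u) (adjoint (prod_deriv X Y) v)"
  shows "(norm (X' ** transpose Y' - Zs))\<^sup>2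
      \<le> (1 - \<gamma> / 8 * (\<omega>0\<^sup>2 / \<omega>2\<^sup>2)) * (norm (X ** transpose Y - Zs))\<^sup>2"
    and "norm ((X', Y') - (X, Y)) \<le> \<gamma> * sqrt (norm (X ** transpose Y - Zs) / Clb)"
proof -
  define D where "D = prod_deriv X Y"
  define e where "e = X ** transpose Y - Zs"
  define \<Delta> where "\<Delta> = h (X ** transpose Y) - h Zs"
  define s where "s = inv (\<lambda>u. adjoint D (D u) + lam *\<^sub>R u) (adjoint D v)"
  define t where "t = inv (\<lambda>u. adjoint D (D u) + lam *\<^sub>R u) (adjoint D e)"
  define p where "p = e - D t"
  have D: "linear D" by (simp add: D_def linear_prod_deriv)
  have s: "adjoint D (D s) + lam *\<^sub>R s = adjoint D v"
    by (rule damped_solution[OF D lam(1) s_def])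
  have t: "adjoint D (D t) + lam *\<^sub>R t = adjoint D e"
    by (rule damped_solution[OF D lam(1) t_def])
  have e0: "e \<noteq> 0" using ne by (simp add: e_def)
  have E: "0 < norm e" using e0 by simp
  have vA: "v \<bullet> w \<le> \<omega>2 * norm w" if "rank w \<le> 2 * CARD('r)" for w
    using subgradient_l1_bound[OF A v[unfolded h_def], of w] upper[OF that] by linarith
  have adj_p: "adjoint D p = lam *\<^sub>R t"
    using t by (simp add: p_def linear_diff[OF adjoint_linear[OF D]] diff_eq_eq add.commute)
  have res: "lam *\<^sub>R (e - p) = p ** Y ** transpose Y + X ** (transpose X ** p)"
  proof -
    have "lam *\<^sub>R (e - p) = D (adjoint D p)"
      unfolding adj_p by (simp add: p_def linear_cmul[OF D])
    then show ?thesis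
      unfolding D_def adjoint_prod_deriv by (simp add: prod_deriv_def matrix_transpose_mul)
  qed
  \<comment> \<open>Both pseudo-inverses produce the same projection \<open>Q\<close>, so \<open>Zs M\<^sup>T L Zs = Xs Q Q Ys\<^sup>T\<close>.\<close>
  have ginv: "Zs ** transpose M ** L ** Zs = Zs"
  proof -
    have "Zs ** transpose M ** L ** Zs = Xs ** (transpose (M ** Ys) ** (L ** Xs)) ** transpose Ys"
      by (simp add: Zs matrix_transpose_mul matrix_mul_assoc)
    then show ?thesis by (simp add: MYs LXs Q XsQ Zs)
  qed
  have Qn: "norm (Q *v x) \<le> norm x" for x
    by (rule norm_projection_vector_le[OF Q(1,2)])
  have l: "0 \<le> 1 / \<mu>" "1 / \<mu> * norm (X - Xs) \<le> 1 / 10" "1 / \<mu> * norm (Y - Ys) \<le> 1 / 10"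
    using near \<mu> by (simp_all add: divide_le_eq)
  \<comment> \<open>The radius \<open>\<mu> / 10\<close> gives \<open>k = 1 / 10\<close>, so \<open>2 k + k\<^sup>2 \<le> 1\<close>.\<close>
  note pert = perturbed_left_inverse_bounds[OF LXs MYs Q(1,2) Qn L M l]
  have n0: "0 \<le> n" by (rule order_trans[OF norm_ge_zero Q(3)])
  have pE: "norm p \<le> \<omega>0 / \<omega>2 / 32 * norm e"
  proof (rule residual_smallness_arith[OF _ _ n0 refl _ _ _ _ _ _ Cub])
    show "(norm p)\<^sup>2 \<le> (norm (mat 1 - Q) + 2 * (1 / 10) + (1 / 10)\<^sup>2) * lam * norm e / 2
        + lam * (11 / 10 * (1 / \<mu>) * norm e)\<^sup>2 / 2 + (1 / \<mu>)\<^sup>2 * norm e ^ 3"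
      using damped_residual_bound[OF lam(1) e_def res ginv L M l(1) pert(1,2) _ pert(3)] by simp
    show "norm (mat 1 - Q) + 2 * (1 / 10) + (1 / 10)\<^sup>2 \<le> n + 1"
      using Q(3) by (simp add: power2_eq_square)
    show "lam \<le> Cub * norm e" using lam(3) by (simp add: e_def)
    show "(1 / \<mu>)\<^sup>2 * norm e \<le> (\<omega>0 / \<omega>2)\<^sup>2 / 2 ^ 19"
      using small \<mu> unfolding e_def[symmetric] by (simp add: field_simps power2_eq_square)
  qed (use \<omega> lam(1) in auto)
  have \<Delta>low: "\<omega>0 * norm e \<le> \<Delta>" using sharp by (simp add: e_def \<Delta>_def)
  then have \<Delta>0: "0 < \<Delta>" by (rule less_le_trans[OF mult_pos_pos[OF \<omega>(1) E]])
  have align: "v \<bullet> (e - D t) \<le> \<Delta> / 16"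
  proof -
    have "v \<bullet> p \<le> 2 * \<omega>2 * norm p"
    proof (rule residual_test_bound[OF vA])
      show "p = X ** transpose Y - Xs ** transpose Ys - prod_deriv X Y (fst t, snd t)"
        by (simp add: p_def e_def Zs D_def)
    qed (use \<omega> in auto)
    also have "\<dots> \<le> 2 * \<omega>2 * (\<omega>0 / \<omega>2 / 32 * norm e)"
      using pE \<omega> by (intro mult_left_mono) auto
    also have "\<dots> = \<omega>0 * norm e / 16" using \<omega> by simp
    also have "\<dots> \<le> \<Delta> / 16" using \<Delta>low by simp
    finally show ?thesis by (simp add: p_def)
  qed
  have \<Delta>v: "\<Delta> \<le> v \<bullet> e"
  proof -
    have "h Zs \<ge> h (X ** transpose Y) + v \<bullet> (Zs - X ** transpose Y)"
      using v by (simp only: subdifferential_def mem_Collect_eq)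
    then show ?thesis by (simp add: \<Delta>_def e_def inner_diff_right)
  qed
  let ?P = "orth_proj (range D) v"
  have \<pi>: "norm ?P \<le> \<omega>2"
  proof -
    have sub: "subspace (range D)" using D by (simp add: linear_subspace_image)
    obtain u where u: "?P = D u" using orth_proj_properties(1)[OF sub, of v] by auto
    have "rank (D u) \<le> CARD('r) + CARD('r)"
      unfolding D_def prod_deriv_def
      by (rule order_trans[OF rank_add_le]) (intro add_mono rank_matrix_mult_le)
    then have "rank ?P \<le> 2 * CARD('r)" unfolding u by simp
    then have "v \<bullet> ?P \<le> \<omega>2 * norm ?P" by (rule vA)
    moreover have "v \<bullet> ?P = norm ?P * norm ?P"
      using orth_proj_properties(2)[OF sub orth_proj_properties(1)[OF sub], of v v]
      by (simp add: inner_diff_left dot_square_norm power2_eq_square)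
    ultimately show ?thesis
      using \<omega> by (cases "norm ?P = 0") (auto simp: mult_le_cancel_right)
  qed
  have gD: "g = \<gamma> * \<Delta> / (norm ?P)\<^sup>2" by (simp add: g D_def \<Delta>_def)
  have stp: "(X', Y') = (X, Y) - g *\<^sub>R s" using step by (simp add: s_def D_def)
  define q where "q = g\<^sup>2 *\<^sub>R (fst s ** transpose (snd s))"
  have q: "norm q \<le> g\<^sup>2 * (norm s)\<^sup>2 / 2"
    using mult_left_mono[OF norm_prod_second_order[of s], of "g\<^sup>2"] by (simp add: q_def)
  note main = damped_polyak_step[OF D lam(1) s t \<Delta>0 \<Delta>v \<Delta>low align refl \<pi> \<omega>(1) \<gamma> Clb
      lam(2)[folded e_def] e0 gD q]
  have new: "X' ** transpose Y' - Zs = e - g *\<^sub>R D s + q"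
    using prod_step[OF stp] by (simp add: e_def D_def q_def)
  show "(norm (X' ** transpose Y' - Zs))\<^sup>2
      \<le> (1 - \<gamma> / 8 * (\<omega>0\<^sup>2 / \<omega>2\<^sup>2)) * (norm (X ** transpose Y - Zs))\<^sup>2"
    unfolding new using main(1) by (simp only: e_def)
  have "0 \<le> g" using \<gamma> \<Delta>0 by (simp add: gD)
  then have "norm ((X', Y') - (X, Y)) = g * norm s" by (simp add: stp)
  then show "norm ((X', Y') - (X, Y)) \<le> \<gamma> * sqrt (norm (X ** transpose Y - Zs) / Clb)"
    using main(2) by (simp add: e_def)
qed

text \<open>
  By Bernoulli's inequality \<open>1 - c \<le> (1 - c / 4)\<^sup>4\<close>, the square root of \<open>E\<close> shrinks by the factor \<open>1 - c / 4\<close>, so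
  \<open>4 / c\<close> times its decrease pays for a step of length \<open>\<surd>E\<close>.
\<close>

lemma geometric_potential_step:
  fixes E E' :: real
  assumes c: "0 < c" "c \<le> 1" and E: "0 \<le> E" "0 \<le> E'"
    and contr: "E'\<^sup>2 \<le> (1 - c) * E\<^sup>2"
  shows "4 / c * sqrt E' + sqrt E \<le> 4 / c * sqrt E"
proof -
  have "1 - c \<le> ((1 - c / 4)\<^sup>2)\<^sup>2"
  proof -
    have "((1 - c / 4)\<^sup>2)\<^sup>2 - (1 - c) = (c / 4)\<^sup>2 * (4 + (2 - c / 4)\<^sup>2 - 2)"
      by (simp add: power2_eq_square field_simps)
    moreover have "0 \<le> (c / 4)\<^sup>2 * (4 + (2 - c / 4)\<^sup>2 - 2)"
      by (intro mult_nonneg_nonneg) auto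
    ultimately show ?thesis by linarith
  qed
  then have "(1 - c) * E\<^sup>2 \<le> ((1 - c / 4)\<^sup>2)\<^sup>2 * E\<^sup>2" by (rule mult_right_mono) simp
  with contr have "E'\<^sup>2 \<le> ((1 - c / 4)\<^sup>2 * E)\<^sup>2" by (simp add: power_mult_distrib)
  then have "E' \<le> (1 - c / 4)\<^sup>2 * E" by (rule power2_le_imp_le) (use E in simp)
  then have "sqrt E' \<le> sqrt ((1 - c / 4)\<^sup>2 * E)" by simp
  also have "\<dots> = (1 - c / 4) * sqrt E" using c by (simp add: real_sqrt_mult)
  finally have "4 / c * sqrt E' \<le> 4 / c * ((1 - c / 4) * sqrt E)"
    using c by (intro mult_left_mono) auto
  also have "\<dots> = 4 / c * sqrt E - sqrt E" using c by (simp add: field_simps)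
  finally show ?thesis by simp
qed

theorem corollary5p15:
  fixes Zs :: "real ^ 'd2 ^ 'd1"
    and Xs :: "real ^ 'r ^ 'd1" and Ys :: "real ^ 'r ^ 'd2"
    and A :: "real ^ 'd2 ^ 'd1 \<Rightarrow> real ^ 'm"
    and I :: "'m set" and \<eta> :: "'m \<Rightarrow> real" and b :: "real ^ 'm"
    and rs :: nat
    and \<omega>0 \<omega>1 \<omega>2 \<gamma> Clb Cub :: real
    and F :: "(real ^ 'r ^ 'd1) \<times> (real ^ 'r ^ 'd2) \<Rightarrow> real ^ 'd2 ^ 'd1"
    and h :: "real ^ 'd2 ^ 'd1 \<Rightarrow> real"
    and X :: "nat \<Rightarrow> real ^ 'r ^ 'd1" and Y :: "nat \<Rightarrow> real ^ 'r ^ 'd2"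
    and v :: "nat \<Rightarrow> real ^ 'd2 ^ 'd1"
    and \<gamma>s lams :: "nat \<Rightarrow> real"
  assumes rank_Zs: "rank Zs = rs" "rs \<le> CARD('r)"
    and omega_pos: "\<omega>0 > 0" "\<omega>1 > 0" "\<omega>2 > 0"
    and A_linear: "linear A"
    and A_rip: "\<And>Z. rank Z \<le> 2 * CARD('r) \<Longrightarrow>
          \<omega>1 * norm Z \<le> l1_on UNIV (A Z) \<and> l1_on UNIV (A Z) \<le> \<omega>2 * norm Z"
    and A_outlier: "\<And>Z. rank Z \<le> 2 * CARD('r) \<Longrightarrow>
          \<omega>0 * norm Z \<le> l1_on (- I) (A Z) - l1_on I (A Z)"
    and b_def: "\<And>i. b $ i = (if i \<in> I then \<eta> i else A Zs $ i)"
    and factorization: "Xs ** transpose Ys = Zs" "rank Xs = rs" "rank Ys = rs"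
    and matching: "same_right_singular_vectors Xs Ys"
    and F_def: "F = (\<lambda>(X, Y). X ** transpose Y)"
    and h_def: "h = (\<lambda>Z. l1_on UNIV (A Z - b))"
    and params: "0 < \<gamma>" "0 < Clb" "Clb \<le> Cub"
    and run: "lmm_polyak h F \<gamma> Clb Cub (\<lambda>k. (X k, Y k)) v \<gamma>s lams"
    and gamma_le: "\<gamma> \<le> min 1 (Clb / sqrt 2)"
    and Cub_le: "Cub \<le> 1 / (2 ^ 7 * 5 * sqrt 2 * (real CARD('r) - real rs + 1)\<^sup>2)
          * (\<omega>0\<^sup>2 / \<omega>2\<^sup>2)
          * (min ((singular_value rs Xs)\<^sup>2) ((singular_value rs Ys)\<^sup>2) / ((singular_value rs Xs)\<^sup>2 + (singular_value rs Ys)\<^sup>2))"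
    and init_factors: "norm ((X 0, Y 0) - (Xs, Ys)) \<le> 1 / (32 * sqrt 2)
          * (min ((singular_value rs Xs)\<^sup>2) ((singular_value rs Ys)\<^sup>2) / max (singular_value 1 Xs) (singular_value 1 Ys))"
    and init_product: "norm (X 0 ** transpose (Y 0) - Zs) \<le> 1 / 2 ^ 19
          * (\<omega>0 ^ 4 / \<omega>2 ^ 4)
          * (min ((singular_value rs Xs) ^ 4) ((singular_value rs Ys) ^ 4)
             / min ((singular_value 1 Xs)\<^sup>2) ((singular_value 1 Ys)\<^sup>2))
          * Clb"
  shows "\<forall>k. (norm (X k ** transpose (Y k) - Zs))\<^sup>2
          \<le> (1 - \<gamma> / 8 * (\<omega>0\<^sup>2 / \<omega>2\<^sup>2)) ^ k
             * (norm (X 0 ** transpose (Y 0) - Zs))\<^sup>2"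
proof -
  obtain V U W and s t :: "nat \<Rightarrow> real" where svd: "is_svd U s V Xs" "is_svd W t V Ys"
    using matching unfolding same_right_singular_vectors_def by blast
  have sX: "singular_value i Xs = s i" and sY: "singular_value i Ys = t i" for i
    using singular_value_eq[OF svd(1)] singular_value_eq[OF svd(2)] by simp_all
  \<comment> \<open>For rank zero the ratio bounding \<open>Cub\<close> is \<open>0 / 0 = 0\<close>, which contradicts \<open>0 < Clb \<le> Cub\<close>.\<close>
  have rs1: "1 \<le> rs"
  proof (rule ccontr)
    assume "\<not> 1 \<le> rs"
    then have "rs = 0" by simp
    moreover have "s 0 = 0" "t 0 = 0" using svd by (auto simp: is_svd_def)
    ultimately have "Cub \<le> 0" using Cub_le by (simp add: sX sY)
    then show False using params by simp
  qed
  have pos: "0 < s rs" "0 < t rs"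
    using svd_nonzero_iff[OF svd(1) factorization(2), of rs] svd_nonzero_iff[OF svd(2) factorization(3), of rs]
      svd rs1 by (auto simp: is_svd_def less_le)
  have top: "s rs \<le> s 1" "t rs \<le> t 1"
    using svd_antimono[OF svd(1) _ rs1] svd_antimono[OF svd(2) _ rs1] by auto
  define \<mu> where "\<mu> = min (s rs) (t rs)"
  have \<mu>: "0 < \<mu>" "\<mu> \<le> s rs" "\<mu> \<le> t rs" using pos by (auto simp: \<mu>_def)
  have min_power: "min (s rs ^ k) (t rs ^ k) = \<mu> ^ k" for k
  proof (cases "s rs \<le> t rs")
    case True
    then have "s rs ^ k \<le> t rs ^ k" using pos by (intro power_mono) auto
    then show ?thesis using True by (simp add: \<mu>_def)
  next
    case False
    then have "t rs ^ k \<le> s rs ^ k" using pos by (intro power_mono) auto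
    then show ?thesis using False by (simp add: \<mu>_def min_def)
  qed
  define n where "n = real (CARD('r) - rs)"
  have n: "n = real CARD('r) - real rs" using rank_Zs(2) by (simp add: n_def of_nat_diff)
  obtain L where L: "L ** Xs = truncation rs V" "Xs ** truncation rs V = Xs"
      "\<And>x. norm (L *v x) \<le> 1 / s rs * norm x"
    using svd_left_inverse[OF svd(1) factorization(2) rs1] by blast
  obtain M where M: "M ** Ys = truncation rs V" "Ys ** truncation rs V = Ys"
      "\<And>x. norm (M *v x) \<le> 1 / t rs * norm x"
    using svd_left_inverse[OF svd(2) factorization(3) rs1] by blast
  have L\<mu>: "norm (L *v x) \<le> 1 / \<mu> * norm x" for x
    by (rule order_trans[OF L(3)]) (use \<mu> pos in \<open>auto intro!: mult_right_mono frac_le\<close>)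
  have M\<mu>: "norm (M *v x) \<le> 1 / \<mu> * norm x" for x
    by (rule order_trans[OF M(3)]) (use \<mu> pos in \<open>auto intro!: mult_right_mono frac_le\<close>)
  have V: "orthogonal_matrix V" using svd by (simp add: is_svd_def)
  note Q = truncation_properties[OF V rank_Zs(2)]

  have F: "F (X', Y') = X' ** transpose Y'" for X' Y' by (simp add: F_def)
  have low_rank: "rank (X' ** transpose Y' - Zs) \<le> 2 * CARD('r)" for X' :: "real ^ 'r ^ 'd1" and Y' :: "real ^ 'r ^ 'd2"
  proof -
    have "rank (X' ** transpose Y' - Zs) \<le> rank (X' ** transpose Y') + rank Zs" by (rule rank_diff_le)
    also have "\<dots> \<le> CARD('r) + CARD('r)"
      using rank_Zs by (intro add_mono rank_matrix_mult_le) simp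
    finally show ?thesis by simp
  qed
  have sharp: "\<omega>0 * norm (X' ** transpose Y' - Zs) \<le> h (X' ** transpose Y') - h Zs"
    for X' :: "real ^ 'r ^ 'd1" and Y' :: "real ^ 'r ^ 'd2"
    using A_outlier[OF low_rank[of X' Y']]
      sharpness[OF A_linear, of I b Zs "X' ** transpose Y'"] b_def
    unfolding h_def by simp
  have \<omega>: "\<omega>0 \<le> \<omega>2"
  proof -
    have "Zs \<noteq> 0" using rank_Zs(1) rs1 by auto
    have "rank Zs \<le> 2 * CARD('r)" using rank_Zs by simp
    then have "\<omega>0 * norm Zs \<le> l1_on (- I) (A Zs) - l1_on I (A Zs)"
      and "l1_on UNIV (A Zs) \<le> \<omega>2 * norm Zs"
      using A_outlier A_rip by blast+
    moreover have "0 \<le> l1_on I (A Zs)" by (simp add: l1_on_def sum_nonneg)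
    ultimately have "\<omega>0 * norm Zs \<le> \<omega>2 * norm Zs"
      using l1_on_split[of "A Zs" I] by linarith
    then show ?thesis using \<open>Zs \<noteq> 0\<close> by (simp add: mult_le_cancel_right)
  qed
  have nonneg: "0 \<le> \<omega>0 * norm (X' ** transpose Y' - Zs)" for X' :: "real ^ 'r ^ 'd1" and Y' :: "real ^ 'r ^ 'd2"
    using omega_pos by simp
  have hmin: "h Zs \<le> h (X' ** transpose Y')" for X' :: "real ^ 'r ^ 'd1" and Y' :: "real ^ 'r ^ 'd2"
    using sharp[of X' Y'] nonneg[of X' Y'] by linarith
  have Zs_F: "Zs = F (Xs, Ys)" by (simp add: F factorization(1))
  have range_min: "h Zs \<le> h w" if "w \<in> range F" for w
    using that hmin by (auto simp: F_def)
  have min_value: "min_value h F = h Zs"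
    unfolding min_value_def
    by (rule cInf_eq_minimum) (use Zs_F range_min in auto)
  have min_set: "min_set h F = {Zs}"
  proof -
    have "w = Zs" if wm: "w \<in> min_set h F" for w
    proof -
      obtain X' :: "real ^ 'r ^ 'd1" and Y' :: "real ^ 'r ^ 'd2" where w: "w = X' ** transpose Y'" using wm by (auto simp: min_set_def F_def)
      have "h w \<le> h Zs" using wm Zs_F by (auto simp: min_set_def)
      then have "\<omega>0 * norm (w - Zs) \<le> 0" using sharp[of X' Y'] w by simp
      then show "w = Zs" using omega_pos(1) by (simp add: mult_le_0_iff)
    qed
    moreover have "Zs \<in> min_set h F" using Zs_F range_min by (auto simp: min_set_def)
    ultimately show ?thesis by blast
  qed

  define \<theta> where "\<theta> = (\<omega>0 / \<omega>2)\<^sup>2"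
  have \<theta>: "0 < \<theta>" "\<theta> \<le> 1"
    using omega_pos \<omega> by (auto simp: \<theta>_def intro!: power_le_one)
  have \<theta>_eq: "\<omega>0\<^sup>2 / \<omega>2\<^sup>2 = \<theta>" "\<omega>0 ^ 4 / \<omega>2 ^ 4 = \<theta>\<^sup>2"
    by (simp_all add: \<theta>_def power_divide flip: power_mult)
  have \<gamma>: "0 < \<gamma>" "\<gamma> \<le> 1" "\<gamma> \<le> Clb / sqrt 2" using params gamma_le by auto
  have Cub: "Cub \<le> \<theta> / (1280 * (n + 1)\<^sup>2)"
  proof -
    have n0: "0 < n + 1" by (simp add: n_def add_pos_nonneg add.commute)
    have ratio: "\<mu>\<^sup>2 / ((s rs)\<^sup>2 + (t rs)\<^sup>2) \<le> 1 / 2"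
    proof -
      have "\<mu>\<^sup>2 \<le> (s rs)\<^sup>2" "\<mu>\<^sup>2 \<le> (t rs)\<^sup>2" using \<mu> by (auto intro!: power_mono)
      moreover have "0 < (s rs)\<^sup>2 + (t rs)\<^sup>2" using pos by (simp add: add_pos_pos)
      ultimately show ?thesis by (simp add: divide_le_eq)
    qed
    have "Cub \<le> 1 / (2 ^ 7 * 5 * sqrt 2 * (n + 1)\<^sup>2) * \<theta> * (\<mu>\<^sup>2 / ((s rs)\<^sup>2 + (t rs)\<^sup>2))"
      using Cub_le unfolding sX sY n[symmetric] \<theta>_eq min_power .
    also have "\<dots> \<le> 1 / (640 * (n + 1)\<^sup>2) * \<theta> * (1 / 2)"
    proof (intro mult_mono ratio order_refl)
      have "640 * (n + 1)\<^sup>2 \<le> 2 ^ 7 * 5 * sqrt 2 * (n + 1)\<^sup>2"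
        by (intro mult_right_mono) auto
      then show "1 / (2 ^ 7 * 5 * sqrt 2 * (n + 1)\<^sup>2) \<le> 1 / (640 * (n + 1)\<^sup>2)"
        using n0 by (intro frac_le) auto
    qed (use \<theta> in auto)
    finally show ?thesis by simp
  qed
  have Clb1: "Clb \<le> 1"
  proof -
    have n1: "1 \<le> (n + 1)\<^sup>2" by (simp add: n_def)
    then have "\<theta> / (1280 * (n + 1)\<^sup>2) \<le> 1 / 1"
      using \<theta> by (intro frac_le) auto
    then show ?thesis using Cub params by linarith
  qed
  define E where "E k = norm (X k ** transpose (Y k) - Zs)" for k
  define d where "d k = norm ((X k, Y k) - (Xs, Ys))" for k
  have E_nn: "0 \<le> E k" for k by (simp add: E_def)
  have init_d: "d 0 \<le> \<mu> / 32"
  proof -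
    have "\<mu> \<le> max (s 1) (t 1)" using \<mu>(2) top by simp
    then have ratio: "\<mu>\<^sup>2 / max (s 1) (t 1) \<le> \<mu>"
      using \<mu>(1) by (simp add: divide_le_eq power2_eq_square)
    have "d 0 \<le> 1 / (32 * sqrt 2) * (\<mu>\<^sup>2 / max (s 1) (t 1))"
      using init_factors unfolding sX sY min_power d_def .
    also have "\<dots> \<le> 1 / 32 * \<mu>"
      by (intro mult_mono ratio) (use \<mu>(1) \<open>\<mu> \<le> max (s 1) (t 1)\<close> in \<open>auto intro!: frac_le\<close>)
    finally show ?thesis by simp
  qed
  have init_E: "E 0 \<le> \<theta>\<^sup>2 * \<mu>\<^sup>2 * Clb / 2 ^ 19"
  proof -
    have m: "\<mu>\<^sup>2 \<le> min ((s 1)\<^sup>2) ((t 1)\<^sup>2)"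
      using \<mu> top by (auto intro!: power_mono)
    have ratio: "\<mu> ^ 4 / min ((s 1)\<^sup>2) ((t 1)\<^sup>2) \<le> \<mu>\<^sup>2"
    proof -
      have "0 < \<mu>\<^sup>2" using \<mu>(1) by simp
      then have m0: "0 < min ((s 1)\<^sup>2) ((t 1)\<^sup>2)" using m by linarith
      have "\<mu> ^ 4 = \<mu>\<^sup>2 * \<mu>\<^sup>2" by (simp flip: power_add)
      also have "\<dots> \<le> \<mu>\<^sup>2 * min ((s 1)\<^sup>2) ((t 1)\<^sup>2)" by (rule mult_left_mono[OF m]) simp
      finally show ?thesis by (rule mult_imp_div_pos_le[OF m0])
    qed
    have "E 0 \<le> 1 / 2 ^ 19 * \<theta>\<^sup>2 * (\<mu> ^ 4 / min ((s 1)\<^sup>2) ((t 1)\<^sup>2)) * Clb"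
      using init_product unfolding sX sY min_power \<theta>_eq E_def .
    also have "\<dots> \<le> 1 / 2 ^ 19 * \<theta>\<^sup>2 * \<mu>\<^sup>2 * Clb"
      using params(2) by (intro mult_right_mono mult_left_mono ratio) auto
    finally show ?thesis by simp
  qed
  define c where "c = \<gamma> / 8 * \<theta>"
  have c: "0 < c" "c \<le> 1"
    using \<gamma> \<theta> mult_mono[of \<gamma> 1 \<theta> 1] by (auto simp: c_def)
  \<comment> \<open>The factor \<open>\<gamma> / sqrt Clb\<close> is the step length per unit of \<open>sqrt E\<close>; \<open>4 / c\<close> sums the geometric series.\<close>
  define K where "K = \<gamma> / sqrt Clb * (4 / c)"
  have K: "0 \<le> K" using \<gamma> params c by (simp add: K_def)
  have K_init: "K * sqrt (E 0) \<le> \<mu> / 16"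
  proof -
    have "sqrt (E 0) \<le> \<theta> * \<mu> * sqrt Clb / 2 ^ 9"
    proof (rule real_le_lsqrt)
      have "\<theta>\<^sup>2 * \<mu>\<^sup>2 * Clb / 2 ^ 19 \<le> \<theta>\<^sup>2 * \<mu>\<^sup>2 * Clb / 2 ^ 18"
        using params(2) by (intro divide_left_mono) auto
      also have "\<dots> = (\<theta> * \<mu> * sqrt Clb / 2 ^ 9)\<^sup>2"
        using params(2) by (simp add: power_mult_distrib power_divide)
      finally show "E 0 \<le> (\<theta> * \<mu> * sqrt Clb / 2 ^ 9)\<^sup>2" using init_E by linarith
    qed (use \<theta> \<mu> params in auto)
    then have "K * sqrt (E 0) \<le> K * (\<theta> * \<mu> * sqrt Clb / 2 ^ 9)"
      using K by (rule mult_left_mono)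
    also have "\<dots> = \<mu> / 16"
      using \<gamma>(1) \<theta> params(2) by (simp add: K_def c_def)
    finally show ?thesis .
  qed
  have "E k \<le> E 0 \<and> d k + K * sqrt (E k) \<le> d 0 + K * sqrt (E 0)
      \<and> (E k)\<^sup>2 \<le> (1 - c) ^ k * (E 0)\<^sup>2" for k
  proof (induction k)
    case 0
    show ?case by simp
  next
    case (Suc k)
    have step: "(E (Suc k))\<^sup>2 \<le> (1 - c) * (E k)\<^sup>2 \<and> d (Suc k) + K * sqrt (E (Suc k)) \<le> d k + K * sqrt (E k)"
    proof (cases "F (X k, Y k) \<in> min_set h F")
      case True
      then have "X (Suc k) = X k" "Y (Suc k) = Y k"
        using run unfolding lmm_polyak_def by (metis prod.inject)+
      moreover have "E k = 0" using True by (simp add: min_set F E_def)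
      ultimately show ?thesis by (simp add: E_def d_def)
    next
      case False
      have ne: "X k ** transpose (Y k) \<noteq> Zs" using False by (simp add: min_set F)
      have D: "frechet_derivative F (at (X k, Y k)) = prod_deriv (X k) (Y k)"
        unfolding F_def by (rule frechet_derivative_prod)
      have "polyak_params h F \<gamma> Clb Cub (X k, Y k) (v k) (\<gamma>s k) (lams k)"
        and "lmm_step h F (\<gamma>s k) (lams k) (v k) (X k, Y k) (X (Suc k), Y (Suc k))"
        using run False unfolding lmm_polyak_def by metis+
      then have g: "\<gamma>s k = \<gamma> * (h (X k ** transpose (Y k)) - h Zs)
            / (norm (orth_proj (range (prod_deriv (X k) (Y k))) (v k)))\<^sup>2"
        and lam: "0 < lams k" "Clb * norm (X k ** transpose (Y k) - Zs) \<le> lams k"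
          "lams k \<le> Cub * norm (X k ** transpose (Y k) - Zs)"
        and v: "v k \<in> subdifferential h (X k ** transpose (Y k))"
        and upd: "(X (Suc k), Y (Suc k)) = (X k, Y k) - \<gamma>s k *\<^sub>R inv (\<lambda>u. adjoint (prod_deriv (X k) (Y k))
            (prod_deriv (X k) (Y k) u) + lams k *\<^sub>R u) (adjoint (prod_deriv (X k) (Y k)) (v k))"
        unfolding polyak_params_def lmm_step_def Let_def D min_value min_set F infdist_singleton
        by (simp_all add: dist_norm)
      \<comment> \<open>The potential bounds the distance: \<open>1/32 + 1/16 < 1/10\<close>.\<close>
      have "d k \<le> \<mu> / 10"
      proof -
        have "0 \<le> K * sqrt (E k)" using K E_nn by simp
        then show ?thesis using Suc.IH init_d K_init \<mu>(1) by linarith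
      qed
      then have near: "norm (X k - Xs) \<le> \<mu> / 10" "norm (Y k - Ys) \<le> \<mu> / 10"
        using norm_fst_le[of "X k - Xs" "Y k - Ys"] norm_snd_le[of "Y k - Ys" "X k - Xs"]
        by (auto simp: d_def)
      have small: "norm (X k ** transpose (Y k) - Zs) \<le> (\<omega>0 / \<omega>2)\<^sup>2 * \<mu>\<^sup>2 / 2 ^ 19"
      proof -
        have "\<theta>\<^sup>2 * \<mu>\<^sup>2 * Clb \<le> \<theta> * \<mu>\<^sup>2 * 1"
          using \<theta> Clb1 params \<mu> by (intro mult_mono) (auto simp: power2_eq_square mult_left_le)
        then show ?thesis
          using Suc.IH init_E by (simp add: E_def \<theta>_def[symmetric])
      qed
      note main = lmm_polyak_step_contracts[OF A_linear h_def _ sharp omega_pos(1) \<omega> factorization(1)[symmetric]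
          L(1) M(1) L(2) Q(1,2) Q(3)[folded n_def] L\<mu> M\<mu> \<mu>(1) near small ne \<gamma> params(2)
          Cub[unfolded \<theta>_def] lam v g upd]
      have contr: "(E (Suc k))\<^sup>2 \<le> (1 - c) * (E k)\<^sup>2"
        using main(1) A_rip by (simp add: E_def c_def \<theta>_eq)
      have move: "norm ((X (Suc k), Y (Suc k)) - (X k, Y k)) \<le> \<gamma> / sqrt Clb * sqrt (E k)"
        using main(2) A_rip by (simp add: E_def real_sqrt_divide)
      have "d (Suc k) \<le> d k + \<gamma> / sqrt Clb * sqrt (E k)"
        using norm_triangle_ineq[of "(X k, Y k) - (Xs, Ys)" "(X (Suc k), Y (Suc k)) - (X k, Y k)"] move
        by (simp add: d_def)
      moreover have "\<gamma> / sqrt Clb * (4 / c * sqrt (E (Suc k)) + sqrt (E k)) \<le> \<gamma> / sqrt Clb * (4 / c * sqrt (E k))"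
        using \<gamma> params by (intro mult_left_mono geometric_potential_step[OF c E_nn E_nn contr]) auto
      ultimately have "d (Suc k) + K * sqrt (E (Suc k)) \<le> d k + K * sqrt (E k)"
        by (simp add: K_def algebra_simps)
      with contr show ?thesis by blast
    qed
    have "(1 - c) * (E k)\<^sup>2 \<le> 1 * (E k)\<^sup>2" using c by (intro mult_right_mono) auto
    then have "(E (Suc k))\<^sup>2 \<le> (E k)\<^sup>2" using step by linarith
    then have "E (Suc k) \<le> E k" by (rule power2_le_imp_le) (rule E_nn)
    moreover have "(1 - c) * (E k)\<^sup>2 \<le> (1 - c) * ((1 - c) ^ k * (E 0)\<^sup>2)"
      using Suc.IH c by (intro mult_left_mono) auto
    ultimately show ?case using step Suc.IH by (auto simp: mult.assoc)
  qed
  then show ?thesis by (simp add: E_def c_def \<theta>_eq)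
qed

end
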